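(* Let $d\ge 1$ and $\rho>0$, and let $(X_n)_{n\in\mathbb{Z}}$ be a sequence of $\mathbb{R}^d$-valued random variables with common bounded marginal density $f$. Let $(K_m)$ be an admissible family of kernels of order $\rho$ for $f$, and let $\hat f_n(x)=\frac1n\sum_{i=1}^nK_{m_n}(x,X_i)$. Assume that $(X_n)$ satisfies at least one of: (J1) for all $j\neq k$ the pair $(X_j,X_k)$ has a joint density $f_{j,k}$, and $\sup_{j\ne k}\|f_{j,k}\|_\infty<\infty$; (J2) $(X_n)$ is a one-dimensional dynamical system belonging to the class $\mathcal F$ (in which case $d=1$). Assume moreover that there exist $a>0$ and $b>0$ such that either $(X_n)$ is $\eta$-weakly dependent with $\eta_r=O(e^{-ar^b})$, or $(X_n)$ is $\tilde\phi$-dependent with $\tilde\phi(r)=O(e^{-ar^b})$. Then for any $M>0$, for all $0<q<+\infty$ and for a suitable choice of the sequence $(m_n)$, $$\mathbb{E}\sup_{\|x\|\le M}|\hat f_n(x)-f(x)|^q=O\left(\left(\frac{\log^{2(b+1)/b}(n)}{n}\right)^{q\rho/(d+2\rho)}\right),$$ and $$\sup_{\|x\|\le M}|\hat f_n(x)-f(x)|=O\left(\left(\frac{\log^{2(b+1)/b}(n)}{n}\right)^{\rho/(d+2\rho)}\right)\quad\text{almost surely.}$$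
   Context: $\|\cdot\|$ is a fixed norm on $\mathbb{R}^d$. For $h:\mathbb{R}^{du}\to\mathbb{R}$, $\mathrm{Lip}(h)=\sup_{(a_1,\dots,a_u)\ne(b_1,\dots,b_u)}\frac{|h(a_1,\dots,a_u)-h(b_1,\dots,b_u)|}{\|a_1-b_1\|+\cdots+\|a_u-b_u\|}$. $\eta$-weak dependence: there are $\eta_r\ge0$, $\eta_r\to0$, such that $|\mathrm{cov}(h(X_{i_1},\dots,X_{i_u}),k(X_{i_{u+1}},\dots,X_{i_{u+v}}))|\le(u\,\mathrm{Lip}(h)+v\,\mathrm{Lip}(k))\eta_r$ for all $i_1\le\cdots\le i_u\le i_u+r\le i_{u+1}\le\cdots\le i_{u+v}$ and all $h:\mathbb{R}^{du}\to\mathbb{R}$, $k:\mathbb{R}^{dv}\to\mathbb{R}$ Lipschitz with sup norm at most $1$. $\tilde\phi$-dependence: for a $\sigma$-algebra $\mathcal M$ and an $\mathbb{R}^{dl}$-valued $X$, $\tilde\phi(\mathcal M,X)=\sup\{\|\mathbb{E}(g(X)|\mathcal M)-\mathbb{E}(g(X))\|_\infty:\ g:\mathbb{R}^{dl}\to\mathbb{R},\ \mathrm{Lip}(g)<1\}$; $\tilde\phi_k(r)=\max_{l\le k}\frac1l\sup_{i+r\le j_1<\cdots<j_l}\tilde\phi(\sigma(X_j;j\le i),(X_{j_1},\dots,X_{j_l}))$; $\tilde\phi(r)=\sup_{k>0}\tilde\phi_k(r)$. The process is $\tilde\phi$-dependent if $\tilde\phi(r)\to0$ as $r\to\infty$.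 Dynamical systems: a one-dimensional dynamical system is $T_k=F^k(T_0)$, where $F:I\to I$, $I\subset\mathbb{R}$ compact, $F^k$ is the $k$-th iterate of $F$, and $T_0$ has law $\mu_0$, an $F$-invariant probability measure absolutely continuous with respect to Lebesgue measure $\lambda$. It belongs to $\mathcal F$ if: for all $k\in\mathbb{N}$ and $x\in\mathrm{int}(I)$ the one-sided limits $F^k(x^+)=\lim_{t\to0^+}F^k(x+t)$ and $F^k(x^-)=\lim_{t\to0^-}F^k(x+t)$ exist; and, with $D^k_\pm=\{x\in\mathrm{int}(I):F^k(x^\pm)=x\}$, $\lambda\left(\bigcup_{k\ge1}(D^k_+\cup D^k_-)\right)=0$. That $(X_n)$ is such a dynamical system means that $X_n$ has law $\mu_0$ and $X_{n+k}=F^k(X_n)$ for all $n$ and $k\ge 0$, or the same after inversion of time ($X_n=F^k(X_{n+k})$, so that $(X_0,\dots,X_n)$ has the law of $(T_n,\dots,T_0)$). Admissible family of kernels of order $\rho$ for $f$: functions $K_m:\mathbb{R}^d\times\mathbb{R}^d\to\mathbb{R}$, $m>0$, such that, with constants in $O(\cdot)$ uniform in $m$ and in the arguments: (a) the functions $y\mapsto K_m(x,y)$ and $y\mapsto K_m(y,x)$ have compact support of diameter $O(m^{-1/d})$; (b) $x\mapsto K_m(x,y)$ and $x\mapsto K_m(y,x)$ are Lipschitz with constant $O(m^{1+1/d})$; (c) $\int K_m(x,y)\,dy=1$ for all $x$ in the support of $K_m$ (i.e. all $x$ with $K_m(x,\cdot)\not\equiv0$); (d) for every $M>0$, $\sup_{\|x\|\le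 M}|\mathbb{E}\hat f_n(x)-f(x)|=O(m_n^{-\rho/d})$ for the bandwidth sequence $(m_n)$ used, $m_n\to\infty$. *)

theory Defs
  imports "HOL-Probability.Probability" "HOL-Library.Landau_Symbols"
begin

definition is_norm :: "('v::real_vector \<Rightarrow> real) \<Rightarrow> bool" where
  "is_norm N \<longleftrightarrow>
     (\<forall>x. N x = 0 \<longleftrightarrow> x = 0) \<and>
     (\<forall>x y. N (x + y) \<le> N x + N y) \<and>
     (\<forall>c x. N (c *\<^sub>R x) = \<bar>c\<bar> * N x)"

text \<open>Landau's O for a possibly infinite nonnegative sequence: a supremum or an expectation that
  may be infinite a priori is kept in \<^typ>\<open>ennreal\<close>, and is finite from some index on.\<close>

definition ennreal_bigo :: "(nat \<Rightarrow> ennreal) \<Rightarrow> (nat \<Rightarrow> real) \<Rightarrow> bool" where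
  "ennreal_bigo g h \<longleftrightarrow> (\<exists>C. \<forall>\<^sub>F n in sequentially. g n \<le> ennreal (C * h n))"


text \<open>A point of the \<open>u\<close>-fold power of \<open>'v\<close> is an element of \<^term>\<open>{..<u} \<rightarrow>\<^sub>E (UNIV :: 'v set)\<close>;
  indices run from \<open>0\<close> to \<open>u - 1\<close>. A function on the power is a HOL function on
  \<^typ>\<open>nat \<Rightarrow> 'v\<close> of which only the values on these points are used.\<close>

definition Lip :: "('v::real_vector \<Rightarrow> real) \<Rightarrow> nat \<Rightarrow> ((nat \<Rightarrow> 'v) \<Rightarrow> real) \<Rightarrow> ennreal" where
  "Lip N u h =
     (SUP (a, b) \<in> {(a, b). a \<in> {..<u} \<rightarrow>\<^sub>E UNIV \<and> b \<in> {..<u} \<rightarrow>\<^sub>E UNIV \<and> a \<noteq> b}.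
        ennreal (\<bar>h a - h b\<bar> / (\<Sum>i<u. N (a i - b i))))"

definition tuple :: "(int \<Rightarrow> 'w \<Rightarrow> 'v) \<Rightarrow> nat \<Rightarrow> (nat \<Rightarrow> int) \<Rightarrow> 'w \<Rightarrow> nat \<Rightarrow> 'v" where
  "tuple X u i \<omega> = (\<lambda>s\<in>{..<u}. X (i s) \<omega>)"

definition cov :: "'w measure \<Rightarrow> ('w \<Rightarrow> real) \<Rightarrow> ('w \<Rightarrow> real) \<Rightarrow> real" where
  "cov M Y Z = (\<integral>\<omega>. Y \<omega> * Z \<omega> \<partial>M) - (\<integral>\<omega>. Y \<omega> \<partial>M) * (\<integral>\<omega>. Z \<omega> \<partial>M)"

definition eta_weakly_dependent ::
  "'w measure \<Rightarrow> ('v::real_vector \<Rightarrow> real) \<Rightarrow> (int \<Rightarrow> 'w \<Rightarrow> 'v) \<Rightarrow> (nat \<Rightarrow> real) \<Rightarrow> bool" where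
  "eta_weakly_dependent M N X \<eta> \<longleftrightarrow>
     (\<forall>r. 0 \<le> \<eta> r) \<and> \<eta> \<longlonglongrightarrow> 0 \<and>
     (\<forall>r u v. \<forall>i j :: nat \<Rightarrow> int. \<forall>h k.
        0 < u \<and> 0 < v \<and> mono_on {..<u} i \<and> mono_on {..<v} j \<and> i (u - 1) + int r \<le> j 0 \<and>
        Lip N u h < \<infinity> \<and> (\<forall>a \<in> {..<u} \<rightarrow>\<^sub>E UNIV. \<bar>h a\<bar> \<le> 1) \<and>
        Lip N v k < \<infinity> \<and> (\<forall>a \<in> {..<v} \<rightarrow>\<^sub>E UNIV. \<bar>k a\<bar> \<le> 1) \<longrightarrow>
        ennreal \<bar>cov M (\<lambda>\<omega>. h (tuple X u i \<omega>)) (\<lambda>\<omega>. k (tuple X v j \<omega>))\<bar>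
          \<le> (of_nat u * Lip N u h + of_nat v * Lip N v k) * ennreal (\<eta> r))"

text \<open>The test functions are those for which the expectation of \<open>g(Z)\<close> exists. If \<open>Z\<close> is
  integrable, this holds for every Lipschitz \<open>g\<close>.\<close>

definition phi_tilde ::
  "'w measure \<Rightarrow> ('v::real_vector \<Rightarrow> real) \<Rightarrow> 'w measure \<Rightarrow> nat \<Rightarrow> ('w \<Rightarrow> nat \<Rightarrow> 'v) \<Rightarrow> ennreal" where
  "phi_tilde M N \<A> l Z =
     (SUP g \<in> {g. Lip N l g < 1 \<and> integrable M (\<lambda>\<omega>. g (Z \<omega>))}.
        esssup M (\<lambda>\<omega>. ennreal
          \<bar>real_cond_exp M \<A> (\<lambda>\<omega>. g (Z \<omega>)) \<omega> - (\<integral>\<omega>. g (Z \<omega>) \<partial>M)\<bar>))"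

definition past :: "'w measure \<Rightarrow> (int \<Rightarrow> 'w \<Rightarrow> 'v::topological_space) \<Rightarrow> int \<Rightarrow> 'w measure" where
  "past M X i = sigma (space M) (\<Union>j\<in>{..i}. {X j -` A \<inter> space M | A. A \<in> sets borel})"

definition phi_tilde_upto ::
  "'w measure \<Rightarrow> ('v::{real_vector,topological_space} \<Rightarrow> real) \<Rightarrow> (int \<Rightarrow> 'w \<Rightarrow> 'v) \<Rightarrow> nat \<Rightarrow> nat \<Rightarrow> ennreal"
where
  "phi_tilde_upto M N X k r =
     (MAX l\<in>{1..k}. ennreal (1 / real l) *
        (SUP (i, j) \<in> {(i, j :: nat \<Rightarrow> int). strict_mono_on {..<l} j \<and> i + int r \<le> j 0}.
           phi_tilde M N (past M X i) l (tuple X l j)))"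

definition phi_tilde_coeff ::
  "'w measure \<Rightarrow> ('v::{real_vector,topological_space} \<Rightarrow> real) \<Rightarrow> (int \<Rightarrow> 'w \<Rightarrow> 'v) \<Rightarrow> nat \<Rightarrow> ennreal"
where
  "phi_tilde_coeff M N X r = (SUP k\<in>{0<..}. phi_tilde_upto M N X k r)"

definition phi_tilde_dependent ::
  "'w measure \<Rightarrow> ('v::{real_vector,topological_space} \<Rightarrow> real) \<Rightarrow> (int \<Rightarrow> 'w \<Rightarrow> 'v) \<Rightarrow> bool"
where
  "phi_tilde_dependent M N X \<longleftrightarrow> phi_tilde_coeff M N X \<longlonglongrightarrow> 0"


definition bounded_joint_densities ::
  "'w measure \<Rightarrow> (int \<Rightarrow> 'w \<Rightarrow> 'v::euclidean_space) \<Rightarrow> bool" where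
  "bounded_joint_densities M X \<longleftrightarrow>
     (\<exists>p :: int \<Rightarrow> int \<Rightarrow> 'v \<times> 'v \<Rightarrow> ennreal.
        (\<forall>j k. j \<noteq> k \<longrightarrow>
           distributed M (lborel \<Otimes>\<^sub>M lborel) (\<lambda>\<omega>. (X j \<omega>, X k \<omega>)) (p j k)) \<and>
        (SUP (j, k) \<in> {(j, k). j \<noteq> k}. esssup (lborel \<Otimes>\<^sub>M lborel) (p j k)) < \<infinity>)"

text \<open>\<open>F\<close> is a self-map of \<open>I\<close>; its values outside \<open>I\<close> play no role.\<close>

definition invariant_acpm :: "real set \<Rightarrow> (real \<Rightarrow> real) \<Rightarrow> real measure \<Rightarrow> bool" where
  "invariant_acpm I F \<mu> \<longleftrightarrow>
     prob_space \<mu> \<and> sets \<mu> = sets borel \<and> emeasure \<mu> I = 1 \<and>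
     absolutely_continuous lborel \<mu> \<and>
     F \<in> borel_measurable (restrict_space borel I) \<and>
     (\<forall>A \<in> sets borel. emeasure \<mu> (F -` A \<inter> I) = emeasure \<mu> A)"

definition dynamical_system :: "real set \<Rightarrow> (real \<Rightarrow> real) \<Rightarrow> real measure \<Rightarrow> bool" where
  "dynamical_system I F \<mu> \<longleftrightarrow> compact I \<and> F \<in> I \<rightarrow> I \<and> invariant_acpm I F \<mu>"

definition D_plus :: "real set \<Rightarrow> (real \<Rightarrow> real) \<Rightarrow> nat \<Rightarrow> real set" where
  "D_plus I F k = {x \<in> interior I. ((\<lambda>t. (F ^^ k) (x + t)) \<longlongrightarrow> x) (at_right 0)}"

definition D_minus :: "real set \<Rightarrow> (real \<Rightarrow> real) \<Rightarrow> nat \<Rightarrow> real set" where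
  "D_minus I F k = {x \<in> interior I. ((\<lambda>t. (F ^^ k) (x + t)) \<longlongrightarrow> x) (at_left 0)}"

definition class_F :: "real set \<Rightarrow> (real \<Rightarrow> real) \<Rightarrow> bool" where
  "class_F I F \<longleftrightarrow>
     (\<forall>k. \<forall>x \<in> interior I.
        (\<exists>l. ((\<lambda>t. (F ^^ k) (x + t)) \<longlongrightarrow> l) (at_right 0)) \<and>
        (\<exists>l. ((\<lambda>t. (F ^^ k) (x + t)) \<longlongrightarrow> l) (at_left 0))) \<and>
     (\<Union>k\<in>{1..}. D_plus I F k \<union> D_minus I F k) \<in> null_sets lebesgue"

text \<open>The orbit relations between random variables are understood almost surely.\<close>

definition follows_dynamics ::
  "'w measure \<Rightarrow> (real \<Rightarrow> real) \<Rightarrow> real measure \<Rightarrow> (int \<Rightarrow> 'w \<Rightarrow> real) \<Rightarrow> bool" where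
  "follows_dynamics M F \<mu> Y \<longleftrightarrow>
     (\<forall>n. Y n \<in> borel_measurable M \<and> distr M borel (Y n) = \<mu>) \<and>
     ((\<forall>n k. AE \<omega> in M. Y (n + int k) \<omega> = (F ^^ k) (Y n \<omega>)) \<or>
      (\<forall>n k. AE \<omega> in M. Y n \<omega> = (F ^^ k) (Y (n + int k) \<omega>)))"

text \<open>A process in dimension one is identified with its only coordinate.\<close>

definition dynamical_system_in_F :: "'w measure \<Rightarrow> (int \<Rightarrow> 'w \<Rightarrow> real ^ 'd::finite) \<Rightarrow> bool" where
  "dynamical_system_in_F M X \<longleftrightarrow>
     CARD('d) = 1 \<and>
     (\<exists>I F \<mu>. dynamical_system I F \<mu> \<and> class_F I F \<and>
        (\<forall>c. follows_dynamics M F \<mu> (\<lambda>n \<omega>. X n \<omega> $ c)))"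


definition estimator ::
  "(real \<Rightarrow> 'v \<Rightarrow> 'v \<Rightarrow> real) \<Rightarrow> (nat \<Rightarrow> real) \<Rightarrow> (int \<Rightarrow> 'w \<Rightarrow> 'v) \<Rightarrow> nat \<Rightarrow> 'w \<Rightarrow> 'v \<Rightarrow> real" where
  "estimator K m X n \<omega> x = (\<Sum>i=1..n. K (m n) x (X (int i) \<omega>)) / real n"

definition support :: "('v::topological_space \<Rightarrow> real) \<Rightarrow> 'v set" where
  "support g = closure {y. g y \<noteq> 0}"

definition small_supports ::
  "('v::euclidean_space \<Rightarrow> real) \<Rightarrow> (real \<Rightarrow> 'v \<Rightarrow> 'v \<Rightarrow> real) \<Rightarrow> bool" where
  "small_supports N K \<longleftrightarrow>
     (\<exists>C. \<forall>m>0. \<forall>x. \<forall>S \<in> {support (\<lambda>y. K m x y), support (\<lambda>y. K m y x)}.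
        compact S \<and> (\<forall>y\<in>S. \<forall>z\<in>S. N (y - z) \<le> C * m powr (- 1 / real DIM('v))))"

definition lipschitz_kernels ::
  "('v::euclidean_space \<Rightarrow> real) \<Rightarrow> (real \<Rightarrow> 'v \<Rightarrow> 'v \<Rightarrow> real) \<Rightarrow> bool" where
  "lipschitz_kernels N K \<longleftrightarrow>
     (\<exists>C. \<forall>m>0. \<forall>x x' y.
        \<bar>K m x y - K m x' y\<bar> \<le> C * m powr (1 + 1 / real DIM('v)) * N (x - x') \<and>
        \<bar>K m y x - K m y x'\<bar> \<le> C * m powr (1 + 1 / real DIM('v)) * N (x - x'))"

definition bias_order ::
  "'w measure \<Rightarrow> ('v::euclidean_space \<Rightarrow> real) \<Rightarrow> (int \<Rightarrow> 'w \<Rightarrow> 'v) \<Rightarrow> ('v \<Rightarrow> real) \<Rightarrow>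
   (nat \<Rightarrow> real) \<Rightarrow> (real \<Rightarrow> 'v \<Rightarrow> 'v \<Rightarrow> real) \<Rightarrow> real \<Rightarrow> bool" where
  "bias_order M N X f m K \<rho> \<longleftrightarrow>
     (\<forall>R>0. ennreal_bigo
        (\<lambda>n. SUP x \<in> {x. N x \<le> R}. ennreal \<bar>(\<integral>\<omega>. estimator K m X n \<omega> x \<partial>M) - f x\<bar>)
        (\<lambda>n. m n powr (- \<rho> / real DIM('v))))"

text \<open>The family is indexed by all \<open>m > 0\<close>; the bias condition concerns the bandwidth sequence
  used in the estimator, so admissibility is relative to that sequence.\<close>

definition admissible_kernels ::
  "'w measure \<Rightarrow> ('v::euclidean_space \<Rightarrow> real) \<Rightarrow> (int \<Rightarrow> 'w \<Rightarrow> 'v) \<Rightarrow> ('v \<Rightarrow> real) \<Rightarrow>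
   (nat \<Rightarrow> real) \<Rightarrow> (real \<Rightarrow> 'v \<Rightarrow> 'v \<Rightarrow> real) \<Rightarrow> real \<Rightarrow> bool" where
  "admissible_kernels M N X f m K \<rho> \<longleftrightarrow>
     small_supports N K \<and> lipschitz_kernels N K \<and>
     (\<forall>m>0. \<forall>x. (\<exists>y. K m x y \<noteq> 0) \<longrightarrow> (\<integral>y. K m x y \<partial>lborel) = 1) \<and>
     bias_order M N X f m K \<rho>"

end

theory Submission
  imports Defs "HOL-Real_Asymp.Real_Asymp"
begin

text \<open>The error of the estimator is the sum of a bias, which is of order \<open>m powr (- \<rho> / d)\<close>
  by admissibility of the kernels, and of a fluctuation around the mean. The bandwidth \<open>m\<close> is chosen
  such that the bias is of the order of the claimed rate; what has to be shown is that the fluctuation exceeds a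
  multiple of the rate somewhere on the ball only with probability smaller than any given power of
  \<open>n\<close> (lemma \<open>uniform_fluctuation_tail\<close>). Almost sure convergence is then the Borel-Cantelli lemma,
  and for the moments the trivial polynomial bound on the error suffices on the exceptional event.

  By the Lipschitz continuity of the kernels, the supremum over the ball reduces to a maximum over
  polynomially many points, so it is enough to treat one point \<open>x\<close>
  (lemma \<open>pointwise_fluctuation_tail\<close>). There the fluctuation is a normalised sum of centred variables
  \<open>\<zeta> (X i)\<close> which are bounded by \<open>O(m)\<close> and, since the marginal density is bounded, have variance
  \<open>O(m)\<close>. The sum is split into \<open>p\<close> arithmetic progressions of difference \<open>p\<close>, where
  \<open>p\<close> is about \<open>ln n powr (2 / b)\<close>. At distance \<open>p\<close>, the dependence is of order
  \<open>exp (- a * (ln n)\<^sup>2)\<close>, smaller than any power of \<open>n\<close>. The splitting costs a factor \<open>p\<close> in the variance,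
  and this is what the logarithmic power in the rate pays for.

  Each progression is treated by the Chernoff method (lemmas \<open>logistic_moment_step\<close> and
  \<open>logistic_moment_bound\<close>). Applied to exponentials of partial sums, a covariance bound for Lipschitz functions is
  useless, because the supremum of such a function is exponential in the number of summands. The exponential is
  therefore replaced by the logistic function \<open>1 / (1 + exp (- \<theta> * (s - T)))\<close>, which is bounded by one
  and Lipschitz, is at least one half beyond the threshold \<open>T\<close>, and starts at a value below
  \<open>exp (- \<theta> * T)\<close>. Its second order expansion has an error proportional to the function itself
  (lemma \<open>logistic_step\<close>), so each summand multiplies the moment by \<open>1 + \<theta>\<^sup>2 * V\<close>, as in the independent
  case, up to an additive covariance error. Both notions of weak dependence control this error, as
  they bound the covariance of a bounded Lipschitz function of the past and of one later observation
  (lemma \<open>eventually_decoupled\<close>).\<close>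

section \<open>The logistic function\<close>

text \<open>The logistic function plays the part of the exponential in the Chernoff method. It is a bounded
  Lipschitz function, hence a legitimate test function for weak dependence, while it still obeys
  \<^term>\<open>logistic x \<le> exp x\<close> and the multiplicative step inequality below, in which the increments
  enter only through a term linear in \<open>y\<close> and a term proportional to the function itself.\<close>

definition logistic :: "real \<Rightarrow> real" where
  "logistic x = 1 / (1 + exp (- x))"

lemma logistic_pos: "0 < logistic x"
  by (simp add: logistic_def add_pos_pos)

lemma logistic_less_1: "logistic x < 1"
  by (simp add: logistic_def add_pos_pos)

lemma logistic_le_exp: "logistic x \<le> exp x"
proof -
  have "logistic x \<le> 1 / exp (- x)"
    unfolding logistic_def by (rule divide_left_mono) (auto intro!: mult_pos_pos add_pos_pos)
  then show ?thesis by (simp add: exp_minus inverse_eq_divide)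
qed

lemma half_le_logistic: "0 \<le> x \<Longrightarrow> 1 / 2 \<le> logistic x"
  unfolding logistic_def by (rule divide_left_mono) (auto intro!: add_pos_pos)

lemma logistic_measurable [measurable]: "logistic \<in> borel_measurable borel"
  unfolding logistic_def by measurable

lemma logistic_DERIV: "(logistic has_real_derivative logistic x * (1 - logistic x)) (at x)"
proof -
  have "1 + exp (- x) \<noteq> 0" using exp_gt_zero[of "- x"] by linarith
  then show ?thesis
    unfolding logistic_def
    by (auto intro!: derivative_eq_intros simp: field_simps power2_eq_square)
qed

lemma logistic_lipschitz: "\<bar>logistic x - logistic y\<bar> \<le> \<bar>x - y\<bar>"
proof -
  have "norm (logistic x - logistic y) \<le> 1 * norm (x - y)"
  proof (rule field_differentiable_bound)
    fix z :: real
    show "(logistic has_field_derivative logistic z * (1 - logistic z)) (at z within UNIV)"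
      by (rule logistic_DERIV)
    show "norm (logistic z * (1 - logistic z)) \<le> 1"
      using logistic_pos[of z] logistic_less_1[of z] by (auto simp: abs_mult intro: mult_le_one)
  qed auto
  then show ?thesis by simp
qed

text \<open>The derivative of the logistic function is the coefficient of the linear term of the step
  inequality, so it must be a Lipschitz test function as well.\<close>

lemma logistic_bell_lipschitz:
  "\<bar>logistic x * (1 - logistic x) - logistic y * (1 - logistic y)\<bar> \<le> \<bar>x - y\<bar>"
proof -
  let ?v = "logistic x" and ?w = "logistic y"
  have "\<bar>?v * (1 - ?v) - ?w * (1 - ?w)\<bar> = \<bar>?v - ?w\<bar> * \<bar>1 - ?v - ?w\<bar>"
    by (simp add: abs_mult[symmetric] algebra_simps)
  also have "\<dots> \<le> \<bar>x - y\<bar> * 1"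
    using logistic_lipschitz[of x y] logistic_pos[of x] logistic_pos[of y]
      logistic_less_1[of x] logistic_less_1[of y]
    by (intro mult_mono) auto
  finally show ?thesis by simp
qed

lemma exp_le_quadratic:
  fixes y :: real
  assumes "\<bar>y\<bar> \<le> 1"
  shows "exp y \<le> 1 + y + y\<^sup>2"
proof (cases "0 \<le> y")
  case True
  then show ?thesis using assms exp_bound by simp
next
  case False
  have "1 \<le> (1 - y) * (1 + y + y\<^sup>2)"
  proof -
    have "(1 - y) * (1 + y + y\<^sup>2) = 1 + (- y) ^ 3"
      by (simp add: algebra_simps power2_eq_square power3_eq_cube)
    then show ?thesis using False by simp
  qed
  also have "\<dots> \<le> exp (- y) * (1 + y + y\<^sup>2)"
  proof (rule mult_right_mono)
    show "1 - y \<le> exp (- y)" using exp_ge_add_one_self[of "- y"] by simp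
    have "0 \<le> y\<^sup>2" by simp
    then show "0 \<le> 1 + y + y\<^sup>2" using assms by linarith
  qed
  finally show ?thesis by (simp add: exp_minus field_simps)
qed

text \<open>With \<open>w = logistic x\<close> and \<open>z = exp y - 1\<close>, the increment of the logistic function is exactly
  \<open>w * (1 - w) * z / (1 + z * w)\<close>. Dropping the denominator only increases it, and
  \<open>z \<le> y + y\<^sup>2\<close>. The quadratic error keeps the factor \<open>w\<close>, which makes the inequality iterable.\<close>

lemma logistic_step:
  assumes "\<bar>y\<bar> \<le> 1"
  shows "logistic (x + y) \<le> logistic x + logistic x * (1 - logistic x) * y + logistic x * y\<^sup>2"
proof -
  define w z where "w = logistic x" and "z = exp y - 1"
  have w: "0 < w" "w < 1" by (auto simp: w_def logistic_pos logistic_less_1)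
  have "0 < 1 - w + w * exp y" using w by (simp add: add_pos_pos)
  then have pos: "0 < 1 + z * w" by (simp add: z_def algebra_simps)
  have px: "0 < 1 + exp x" and pxy: "0 < 1 + exp x * exp y" by (simp_all add: add_pos_pos)
  have ww: "w = exp x / (1 + exp x)"
    using px by (simp add: w_def logistic_def exp_minus field_simps)
  have "logistic (x + y) = exp x * exp y / (1 + exp x * exp y)"
    using pxy by (simp add: logistic_def exp_minus exp_add exp_diff field_simps)
  moreover have "1 + z * w = (1 + exp x * exp y) / (1 + exp x)"
    using px by (simp add: ww z_def field_simps)
  moreover have "w * (1 + z) = exp x * exp y / (1 + exp x)" by (simp add: ww z_def)
  ultimately have "logistic (x + y) = w * (1 + z) / (1 + z * w)"
    using px pxy by simp
  also have "\<dots> = w + w * (1 - w) * (z / (1 + z * w))"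
    using pos by (simp add: field_simps)
  also have "z / (1 + z * w) \<le> z"
  proof -
    have "z - z / (1 + z * w) = z\<^sup>2 * w / (1 + z * w)"
      using pos by (simp add: field_simps power2_eq_square)
    moreover have "0 \<le> z\<^sup>2 * w / (1 + z * w)" using pos w by simp
    ultimately show ?thesis by simp
  qed
  then have "w + w * (1 - w) * (z / (1 + z * w)) \<le> w + w * (1 - w) * z"
    using w by (intro add_left_mono mult_left_mono) auto
  also have "\<dots> \<le> w + w * (1 - w) * (y + y\<^sup>2)"
    using w exp_le_quadratic[OF assms] by (intro add_left_mono mult_left_mono) (auto simp: z_def)
  also have "\<dots> \<le> w + w * (1 - w) * y + w * y\<^sup>2"
  proof -
    have "w * (1 - w) * y\<^sup>2 \<le> w * y\<^sup>2" using w by (intro mult_right_mono) auto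
    then show ?thesis by (simp add: distrib_left)
  qed
  finally show ?thesis by (simp add: w_def)
qed

section \<open>Norms on a Euclidean space\<close>

lemma is_norm_nonneg:
  assumes "is_norm N" shows "0 \<le> N x"
proof -
  have "N (x + (-1) *\<^sub>R x) \<le> N x + N ((-1) *\<^sub>R x)" "N ((-1) *\<^sub>R x) = \<bar>-1\<bar> * N x" "N 0 = 0"
    using assms unfolding is_norm_def by blast+
  then show ?thesis by simp
qed

lemma is_norm_pos: "is_norm N \<Longrightarrow> x \<noteq> 0 \<Longrightarrow> 0 < N x"
  using is_norm_nonneg[of N x] unfolding is_norm_def by (metis less_le)

lemma is_norm_zero: "is_norm N \<Longrightarrow> N 0 = 0"
  unfolding is_norm_def by blast

lemma is_norm_scale: "is_norm N \<Longrightarrow> N (c *\<^sub>R x) = \<bar>c\<bar> * N x"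
  unfolding is_norm_def by blast

lemma is_norm_minus_commute:
  assumes "is_norm N" shows "N (x - y) = N (y - x)"
proof -
  have "N ((-1) *\<^sub>R (y - x)) = \<bar>-1\<bar> * N (y - x)" using assms by (rule is_norm_scale)
  then show ?thesis by simp
qed

lemma is_norm_sum:
  assumes "is_norm N"
  shows "N (\<Sum>i\<in>I. v i) \<le> (\<Sum>i\<in>I. N (v i))"
proof (induction I rule: infinite_finite_induct)
  case (insert i I)
  have "N (v i + sum v I) \<le> N (v i) + N (sum v I)"
    using assms unfolding is_norm_def by blast
  then show ?case using insert by simp
qed (auto simp: is_norm_zero[OF assms])

lemma is_norm_le_norm:
  fixes N :: "'v::euclidean_space \<Rightarrow> real"
  assumes "is_norm N"
  obtains c where "0 < c" "\<And>x. N x \<le> c * norm x"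
proof
  let ?c = "(\<Sum>b\<in>Basis. N b) + 1 :: real"
  have s: "0 \<le> (\<Sum>b\<in>Basis. N b)" by (simp add: sum_nonneg is_norm_nonneg[OF assms])
  then show "0 < ?c" by linarith
  show "N x \<le> ?c * norm x" for x :: 'v
  proof -
    have "N x = N (\<Sum>b\<in>Basis. (x \<bullet> b) *\<^sub>R b)" by (simp add: euclidean_representation)
    also have "\<dots> \<le> (\<Sum>b\<in>Basis. N ((x \<bullet> b) *\<^sub>R b))" by (rule is_norm_sum[OF assms])
    also have "\<dots> \<le> (\<Sum>b\<in>Basis. norm x * N b)"
      by (rule sum_mono)
        (auto simp: is_norm_scale[OF assms] Basis_le_norm intro!: mult_right_mono is_norm_nonneg[OF assms])
    also have "\<dots> \<le> ?c * norm x" by (simp add: sum_distrib_left[symmetric] distrib_left mult.commute[of _ "norm x"])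
    finally show ?thesis .
  qed
qed

lemma is_norm_diff_le:
  assumes "is_norm N" shows "\<bar>N x - N y\<bar> \<le> N (x - y)"
proof -
  have "N (y + (x - y)) \<le> N y + N (x - y)" "N (x + (y - x)) \<le> N x + N (y - x)"
    using assms unfolding is_norm_def by blast+
  then show ?thesis using is_norm_minus_commute[OF assms, of x y] by simp
qed

lemma continuous_on_if_lipschitz:
  fixes N :: "'v::euclidean_space \<Rightarrow> real" and g :: "'v \<Rightarrow> real"
  assumes "is_norm N" and "\<And>x y. \<bar>g x - g y\<bar> \<le> L * N (x - y)"
  shows "continuous_on UNIV g"
proof -
  obtain c where c: "0 < c" "\<And>x. N x \<le> c * norm x" using is_norm_le_norm[OF assms(1)] by blast
  have "(\<bar>L\<bar> * c)-lipschitz_on UNIV g"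
  proof (rule lipschitz_onI)
    fix x y :: 'v
    have "\<bar>g x - g y\<bar> \<le> L * N (x - y)" by (rule assms)
    also have "\<dots> \<le> \<bar>L\<bar> * N (x - y)"
      by (intro mult_right_mono is_norm_nonneg[OF assms(1)]) auto
    also have "\<dots> \<le> \<bar>L\<bar> * (c * norm (x - y))" by (intro mult_left_mono c) auto
    finally show "dist (g x) (g y) \<le> \<bar>L\<bar> * c * dist x y" by (simp add: dist_norm mult.assoc)
  qed (use c in auto)
  then show ?thesis by (rule lipschitz_on_continuous_on)
qed

lemma borel_measurable_if_lipschitz:
  fixes N :: "'v::euclidean_space \<Rightarrow> real" and g :: "'v \<Rightarrow> real"
  assumes "is_norm N" and "\<And>x y. \<bar>g x - g y\<bar> \<le> L * N (x - y)"
  shows "g \<in> borel_measurable borel"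
  by (rule borel_measurable_continuous_onI[OF continuous_on_if_lipschitz[OF assms]])

text \<open>Equivalence with the Euclidean norm: a norm is continuous and positive on the compact unit
  sphere, so it has a positive minimum there.\<close>

lemma norm_le_is_norm:
  fixes N :: "'v::euclidean_space \<Rightarrow> real"
  assumes "is_norm N"
  obtains c where "0 < c" "\<And>x. norm x \<le> c * N x"
proof -
  have "\<bar>N x - N y\<bar> \<le> 1 * N (x - y)" for x y using is_norm_diff_le[OF assms] by simp
  then have "continuous_on UNIV N" by (rule continuous_on_if_lipschitz[OF assms])
  then have "continuous_on (sphere (0::'v) 1) N" by (rule continuous_on_subset) simp
  moreover obtain e :: 'v where "e \<in> Basis" using nonempty_Basis by blast
  then have "sphere (0::'v) 1 \<noteq> {}" by (auto intro!: exI[of _ e])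
  ultimately obtain s where s: "s \<in> sphere (0::'v) 1" "\<And>y. y \<in> sphere 0 1 \<Longrightarrow> N s \<le> N y"
    using continuous_attains_inf[of "sphere (0::'v) 1" N] by auto
  have sp: "0 < N s" using s(1) by (intro is_norm_pos[OF assms]) auto
  show ?thesis
  proof
    show "0 < 1 / N s" using sp by simp
    show "norm x \<le> 1 / N s * N x" for x :: 'v
    proof (cases "x = 0")
      case False
      have "N s \<le> N ((1 / norm x) *\<^sub>R x)" using False by (intro s) auto
      also have "\<dots> = N x / norm x" using is_norm_scale[OF assms] by simp
      finally show ?thesis using False sp by (simp add: field_simps)
    qed (simp add: is_norm_zero[OF assms])
  qed
qed

section \<open>Decoupling a bounded Lipschitz past from a single future observation\<close>

text \<open>The common consequence of both notions of dependence that the proof uses: test functions on an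
  arbitrarily long past are compared with a test function of one later observation only. As the
  test functions are bounded by one, only their Lipschitz constants enter the bound, and the long
  past contributes a factor that is merely linear in its length.\<close>

definition decoupled ::
  "'w measure \<Rightarrow> ('v::euclidean_space \<Rightarrow> real) \<Rightarrow> (int \<Rightarrow> 'w \<Rightarrow> 'v) \<Rightarrow> nat \<Rightarrow> real \<Rightarrow> bool" where
  "decoupled M N X r \<delta> \<longleftrightarrow>
     (\<forall>u i j h k L1 L2.
        strict_mono_on {..<u} i \<and> (\<forall>t<u. i t + int r \<le> j) \<and> 0 < L1 \<and> 0 < L2 \<and>
        h \<in> borel_measurable (Pi\<^sub>M {..<u} (\<lambda>_. borel)) \<and> k \<in> borel_measurable borel \<and>
        (\<forall>c \<in> {..<u} \<rightarrow>\<^sub>E UNIV. \<bar>h c\<bar> \<le> 1) \<and> (\<forall>c. \<bar>k c\<bar> \<le> 1) \<and>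
        (\<forall>c \<in> {..<u} \<rightarrow>\<^sub>E UNIV. \<forall>c' \<in> {..<u} \<rightarrow>\<^sub>E UNIV.
           \<bar>h c - h c'\<bar> \<le> L1 * (\<Sum>t<u. N (c t - c' t))) \<and>
        (\<forall>x y. \<bar>k x - k y\<bar> \<le> L2 * N (x - y)) \<longrightarrow>
        \<bar>cov M (\<lambda>\<omega>. h (tuple X u i \<omega>)) (\<lambda>\<omega>. k (X j \<omega>))\<bar> \<le> (real u * L1 + L2) * \<delta>)"

lemma decoupledD:
  assumes "decoupled M N X r \<delta>"
    and "strict_mono_on {..<u} i" "\<And>t. t < u \<Longrightarrow> i t + int r \<le> j" "0 < L1" "0 < L2"
    and "h \<in> borel_measurable (Pi\<^sub>M {..<u} (\<lambda>_. borel))" "k \<in> borel_measurable borel"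
    and "\<And>c. c \<in> {..<u} \<rightarrow>\<^sub>E UNIV \<Longrightarrow> \<bar>h c\<bar> \<le> 1" "\<And>c. \<bar>k c\<bar> \<le> 1"
    and "\<And>c c'. c \<in> {..<u} \<rightarrow>\<^sub>E UNIV \<Longrightarrow> c' \<in> {..<u} \<rightarrow>\<^sub>E UNIV \<Longrightarrow>
           \<bar>h c - h c'\<bar> \<le> L1 * (\<Sum>t<u. N (c t - c' t))"
    and "\<And>x y. \<bar>k x - k y\<bar> \<le> L2 * N (x - y)"
  shows "\<bar>cov M (\<lambda>\<omega>. h (tuple X u i \<omega>)) (\<lambda>\<omega>. k (X j \<omega>))\<bar> \<le> (real u * L1 + L2) * \<delta>"
  by (rule assms(1)[unfolded decoupled_def, THEN spec[where x = u], THEN spec[where x = i], THEN spec[where x = j],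
        THEN spec[where x = h], THEN spec[where x = k], THEN spec[where x = L1], THEN spec[where x = L2], THEN mp])
    (intro conjI allI ballI impI; (rule assms(2-); assumption?; assumption?))

lemma PiE_neq_sum_pos:
  fixes u :: nat
  assumes "is_norm N" "c \<in> {..<u} \<rightarrow>\<^sub>E UNIV" "c' \<in> {..<u} \<rightarrow>\<^sub>E UNIV" "c \<noteq> c'"
  shows "0 < (\<Sum>t<u. N (c t - c' t))"
proof -
  obtain t where t: "t < u" "c t \<noteq> c' t"
    using assms PiE_ext[OF assms(2,3)] by auto
  then have "0 < N (c t - c' t)" by (intro is_norm_pos[OF assms(1)]) simp
  then show ?thesis using t by (intro sum_pos2[of _ t]) (auto intro: is_norm_nonneg[OF assms(1)])
qed

text \<open>The supremum that defines \<^const>\<open>Lip\<close> divides by a sum of norms, which is nonzero for distinct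
  points of the power.\<close>

lemma Lip_le:
  assumes "is_norm N"
    and "\<And>c c'. c \<in> {..<u} \<rightarrow>\<^sub>E UNIV \<Longrightarrow> c' \<in> {..<u} \<rightarrow>\<^sub>E UNIV \<Longrightarrow>
           \<bar>h c - h c'\<bar> \<le> L * (\<Sum>t<u. N (c t - c' t))"
  shows "Lip N u h \<le> ennreal L"
  unfolding Lip_def
proof (intro SUP_least, clarify)
  fix c c' :: "nat \<Rightarrow> 'a"
  assume c: "c \<in> {..<u} \<rightarrow>\<^sub>E UNIV" "c' \<in> {..<u} \<rightarrow>\<^sub>E UNIV" "c \<noteq> c'"
  show "ennreal (\<bar>h c - h c'\<bar> / (\<Sum>t<u. N (c t - c' t))) \<le> ennreal L"
    using PiE_neq_sum_pos[OF assms(1) c] assms(2)[OF c(1,2)]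
    by (intro ennreal_leI) (simp add: pos_divide_le_eq)
qed

lemma tuple_in_PiE: "tuple X u i \<omega> \<in> {..<u} \<rightarrow>\<^sub>E UNIV"
  by (simp add: tuple_def)

lemma decoupled_if_eta:
  fixes N :: "'v::euclidean_space \<Rightarrow> real"
  assumes "prob_space M" "is_norm N" "eta_weakly_dependent M N X \<eta>"
  shows "decoupled M N X r (\<eta> r)"
  unfolding decoupled_def
proof (intro allI impI, elim conjE)
  fix u and i :: "nat \<Rightarrow> int" and j :: int and h :: "(nat \<Rightarrow> 'v) \<Rightarrow> real" and k :: "'v \<Rightarrow> real"
    and L1 L2 :: real
  assume i: "strict_mono_on {..<u} i" "\<forall>t<u. i t + int r \<le> j"
    and L: "0 < L1" "0 < L2"
    and b: "\<forall>c \<in> {..<u} \<rightarrow>\<^sub>E UNIV. \<bar>h c\<bar> \<le> 1" "\<forall>c. \<bar>k c\<bar> \<le> 1"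
    and hL: "\<forall>c \<in> {..<u} \<rightarrow>\<^sub>E UNIV. \<forall>c' \<in> {..<u} \<rightarrow>\<^sub>E UNIV.
           \<bar>h c - h c'\<bar> \<le> L1 * (\<Sum>t<u. N (c t - c' t))"
    and kL: "\<forall>x y. \<bar>k x - k y\<bar> \<le> L2 * N (x - y)"
  interpret prob_space M by fact
  have \<eta>: "0 \<le> \<eta> r" using assms(3) unfolding eta_weakly_dependent_def by blast
  show "\<bar>cov M (\<lambda>\<omega>. h (tuple X u i \<omega>)) (\<lambda>\<omega>. k (X j \<omega>))\<bar> \<le> (real u * L1 + L2) * \<eta> r"
  proof (cases "u = 0")
    case True
    \<comment> \<open>An empty tuple is deterministic.\<close>
    then have "h (tuple X u i \<omega>) = h (\<lambda>_. undefined)" for \<omega> by (simp add: tuple_def restrict_def)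
    then show ?thesis using L \<eta> by (simp add: cov_def prob_space True)
  next
    case False
    define k' where "k' = (\<lambda>c :: nat \<Rightarrow> 'v. k (c 0))"
    have Lh: "Lip N u h \<le> ennreal L1" using hL by (intro Lip_le assms) auto
    have Lk: "Lip N 1 k' \<le> ennreal L2" using kL by (intro Lip_le assms) (auto simp: k'_def)
    have fin: "Lip N u h < \<infinity>" "Lip N 1 k' < \<infinity>"
      using Lh Lk by (auto intro: le_less_trans)
    have eta_rule: "ennreal \<bar>cov M (\<lambda>\<omega>. h (tuple X u i \<omega>)) (\<lambda>\<omega>. k' (tuple X v j' \<omega>))\<bar>
          \<le> (of_nat u * Lip N u h + of_nat v * Lip N v k') * ennreal (\<eta> r)"
      if "0 < u \<and> 0 < v \<and> mono_on {..<u} i \<and> mono_on {..<v} j' \<and> i (u - 1) + int r \<le> j' 0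
          \<and> Lip N u h < \<infinity> \<and> (\<forall>c \<in> {..<u} \<rightarrow>\<^sub>E UNIV. \<bar>h c\<bar> \<le> 1)
          \<and> Lip N v k' < \<infinity> \<and> (\<forall>c \<in> {..<v} \<rightarrow>\<^sub>E UNIV. \<bar>k' c\<bar> \<le> 1)" for v and j' :: "nat \<Rightarrow> int"
      using that assms(3) unfolding eta_weakly_dependent_def by blast
    have "ennreal \<bar>cov M (\<lambda>\<omega>. h (tuple X u i \<omega>)) (\<lambda>\<omega>. k' (tuple X 1 (\<lambda>_. j) \<omega>))\<bar>
          \<le> (of_nat u * Lip N u h + of_nat 1 * Lip N 1 k') * ennreal (\<eta> r)"
    proof (rule eta_rule)
      show "0 < u \<and> (0::nat) < 1 \<and> mono_on {..<u} i \<and> mono_on {..<1} (\<lambda>_::nat. j)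
          \<and> i (u - 1) + int r \<le> j
          \<and> Lip N u h < \<infinity> \<and> (\<forall>c \<in> {..<u} \<rightarrow>\<^sub>E UNIV. \<bar>h c\<bar> \<le> 1)
          \<and> Lip N 1 k' < \<infinity> \<and> (\<forall>c \<in> {..<1} \<rightarrow>\<^sub>E UNIV. \<bar>k' c\<bar> \<le> 1)"
        using False i b fin strict_mono_on_imp_mono_on[OF i(1)] by (auto simp: k'_def mono_on_const)
    qed
    also have "\<dots> \<le> (ennreal (real u) * ennreal L1 + ennreal L2) * ennreal (\<eta> r)"
      using Lh Lk by (intro mult_right_mono add_mono mult_mono) (auto simp: ennreal_of_nat_eq_real_of_nat)
    also have "\<dots> = ennreal ((real u * L1 + L2) * \<eta> r)"
      using L \<eta> by (simp add: ennreal_mult ennreal_plus)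
    finally show ?thesis
      using L \<eta> by (simp add: k'_def tuple_def)
  qed
qed

text \<open>Conditioning on the past turns the covariance of \<open>Y\<close> and \<open>G\<close> into the integral of
  \<open>Y * (E(G | past) - E(G))\<close>, where \<open>Y\<close> is bounded by one and the second factor is uniformly small.
  The factor two comes from normalising the test function to a Lipschitz constant below one.\<close>

lemma decoupled_if_phi:
  fixes N :: "'v::euclidean_space \<Rightarrow> real"
  assumes "prob_space M" "is_norm N" "\<And>n. X n \<in> borel_measurable M"
    and "phi_tilde_coeff M N X r \<le> ennreal \<delta>" "0 \<le> \<delta>"
  shows "decoupled M N X r (2 * \<delta>)"
  unfolding decoupled_def
proof (intro allI impI, elim conjE)
  fix u and i :: "nat \<Rightarrow> int" and j :: int and h :: "(nat \<Rightarrow> 'v) \<Rightarrow> real" and k :: "'v \<Rightarrow> real"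
    and L1 L2 :: real
  assume i: "strict_mono_on {..<u} i" "\<forall>t<u. i t + int r \<le> j"
    and L: "0 < L1" "0 < L2"
    and h [measurable]: "h \<in> borel_measurable (Pi\<^sub>M {..<u} (\<lambda>_. borel))"
    and k [measurable]: "k \<in> borel_measurable borel"
    and b: "\<forall>c \<in> {..<u} \<rightarrow>\<^sub>E UNIV. \<bar>h c\<bar> \<le> 1" "\<forall>c. \<bar>k c\<bar> \<le> 1"
    and kL: "\<forall>x y. \<bar>k x - k y\<bar> \<le> L2 * N (x - y)"
  interpret prob_space M by fact
  note [measurable] = assms(3)
  define F where "F = past M X (j - int r)"
  have spF: "space F = space M" and
    setsF: "sets F = sigma_sets (space M) (\<Union>j\<in>{..j - int r}. {X j -` A \<inter> space M | A. A \<in> sets borel})"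
    unfolding F_def past_def by (auto simp: space_measure_of_conv intro!: sets_measure_of)
  have XF: "X s \<in> borel_measurable F" if "s \<le> j - int r" for s
    using that by (intro measurableI) (auto simp: spF setsF intro!: sigma_sets.Basic)
  have sub: "subalgebra M F"
    unfolding subalgebra_def
  proof
    show "sets F \<subseteq> sets M" unfolding setsF
      by (rule sets.sigma_sets_subset) (auto intro: measurable_sets[OF assms(3)])
  qed (rule spF)
  then interpret F: finite_measure_subalgebra M F by unfold_locales
  define Y where "Y = (\<lambda>\<omega>. h (tuple X u i \<omega>))"
  have YF: "Y \<in> borel_measurable F"
  proof -
    have "tuple X u i \<in> measurable F (Pi\<^sub>M {..<u} (\<lambda>_. borel))"
      unfolding tuple_def by (rule measurable_restrict) (use i in \<open>auto intro!: XF\<close>)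
    then show ?thesis unfolding Y_def by measurable
  qed
  then have YM [measurable]: "Y \<in> borel_measurable M" by (rule measurable_from_subalg[OF sub])
  have Yb: "\<bar>Y \<omega>\<bar> \<le> 1" for \<omega> using b tuple_in_PiE[of X u i \<omega>] by (auto simp: Y_def)
  have iY: "integrable M Y" by (rule integrable_const_bound[of _ 1]) (use Yb in auto)
  \<comment> \<open>The test functions of the coefficient have Lipschitz constant strictly below one.\<close>
  define g where "g = (\<lambda>c :: nat \<Rightarrow> 'v. k (c 0) / (2 * L2))"
  define G where "G = (\<lambda>\<omega>. k (X j \<omega>) / (2 * L2))"
  have gG: "g (tuple X 1 (\<lambda>_. j) \<omega>) = G \<omega>" for \<omega> by (simp add: g_def G_def tuple_def)
  have GM [measurable]: "G \<in> borel_measurable M" unfolding G_def by measurable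
  have iG: "integrable M G"
    by (rule integrable_const_bound[of _ "1 / (2 * L2)"]) (use b L in \<open>auto simp: G_def divide_right_mono\<close>)
  have iYG: "integrable M (\<lambda>\<omega>. Y \<omega> * G \<omega>)"
  proof (rule integrable_const_bound[of _ "1 * (1 / (2 * L2))"])
    show "AE \<omega> in M. norm (Y \<omega> * G \<omega>) \<le> 1 * (1 / (2 * L2))"
      unfolding real_norm_def abs_mult
      by (intro AE_I2 mult_mono Yb) (use b L in \<open>auto simp: G_def divide_right_mono\<close>)
  qed measurable
  have "Lip N 1 g \<le> ennreal (1 / 2)"
  proof (rule Lip_le[OF assms(2)])
    fix c c' :: "nat \<Rightarrow> 'v"
    have "\<bar>g c - g c'\<bar> = \<bar>k (c 0) - k (c' 0)\<bar> / (2 * L2)"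
      using L by (simp add: g_def diff_divide_distrib[symmetric])
    also have "\<dots> \<le> L2 * N (c 0 - c' 0) / (2 * L2)" using kL L by (intro divide_right_mono) auto
    finally show "\<bar>g c - g c'\<bar> \<le> 1 / 2 * (\<Sum>t<1. N (c t - c' t))" using L by simp
  qed
  also have "\<dots> < 1" by (subst ennreal_1[symmetric], rule ennreal_lessI) auto
  finally have Lg: "Lip N 1 g < 1" .
  define E where "E = real_cond_exp M F G"
  let ?mG = "\<integral>\<omega>. G \<omega> \<partial>M"
  have "esssup M (\<lambda>\<omega>. ennreal \<bar>E \<omega> - ?mG\<bar>) \<le> phi_tilde M N F 1 (tuple X 1 (\<lambda>_. j))"
    unfolding phi_tilde_def E_def
    by (rule SUP_upper2[of g]) (use Lg iG gG in \<open>simp_all del: One_nat_def\<close>)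
  also have "\<dots> \<le> (SUP (i, j) \<in> {(i, j :: nat \<Rightarrow> int). strict_mono_on {..<1} j \<and> i + int r \<le> j 0}.
           phi_tilde M N (past M X i) 1 (tuple X 1 j))"
    unfolding F_def by (rule SUP_upper2[of "(j - int r, \<lambda>_. j)"]) (auto simp: strict_mono_on_def)
  also have "\<dots> = phi_tilde_upto M N X 1 r"
    unfolding phi_tilde_upto_def by simp
  also have "\<dots> \<le> phi_tilde_coeff M N X r"
    unfolding phi_tilde_coeff_def by (rule SUP_upper) simp
  also have "\<dots> \<le> ennreal \<delta>" by fact
  finally have es: "esssup M (\<lambda>\<omega>. ennreal \<bar>E \<omega> - ?mG\<bar>) \<le> ennreal \<delta>" .
  have EM [measurable]: "E \<in> borel_measurable M" unfolding E_def by (rule borel_measurable_cond_exp2)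
  have ae: "AE \<omega> in M. \<bar>E \<omega> - ?mG\<bar> \<le> \<delta>"
    using esssup_AE[of "\<lambda>\<omega>. ennreal \<bar>E \<omega> - ?mG\<bar>" M]
  proof eventually_elim
    case (elim \<omega>)
    then have "ennreal \<bar>E \<omega> - ?mG\<bar> \<le> ennreal \<delta>" using es by simp
    then show ?case using assms(5) by simp
  qed
  have iYE: "integrable M (\<lambda>\<omega>. Y \<omega> * E \<omega>)" and eYE: "(\<integral>\<omega>. Y \<omega> * E \<omega> \<partial>M) = (\<integral>\<omega>. Y \<omega> * G \<omega> \<partial>M)"
    unfolding E_def using F.real_cond_exp_intg[OF iYG YF GM] by auto
  have iYE': "integrable M (\<lambda>\<omega>. Y \<omega> * (E \<omega> - ?mG))"
    using iYE iY by (simp add: right_diff_distrib)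
  have "(\<integral>\<omega>. Y \<omega> * G \<omega> \<partial>M) - (\<integral>\<omega>. Y \<omega> \<partial>M) * ?mG = (\<integral>\<omega>. Y \<omega> * (E \<omega> - ?mG) \<partial>M)"
    using iYE iY by (simp add: right_diff_distrib eYE)
  also have "\<bar>\<dots>\<bar> \<le> (\<integral>\<omega>. \<bar>Y \<omega> * (E \<omega> - ?mG)\<bar> \<partial>M)" by (rule integral_abs_bound)
  also have "\<dots> \<le> (\<integral>\<omega>. \<delta> \<partial>M)"
  proof (rule integral_mono_AE)
    show "AE \<omega> in M. \<bar>Y \<omega> * (E \<omega> - ?mG)\<bar> \<le> \<delta>"
      using ae
    proof eventually_elim
      case (elim \<omega>)
      have "\<bar>Y \<omega>\<bar> * \<bar>E \<omega> - ?mG\<bar> \<le> 1 * \<delta>" using elim Yb[of \<omega>] by (intro mult_mono) auto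
      then show ?case by (simp add: abs_mult)
    qed
  qed (use iYE' in auto)
  finally have main: "\<bar>(\<integral>\<omega>. Y \<omega> * G \<omega> \<partial>M) - (\<integral>\<omega>. Y \<omega> \<partial>M) * ?mG\<bar> \<le> \<delta>" by (simp add: prob_space)
  have kG: "k (X j \<omega>) = 2 * L2 * G \<omega>" for \<omega> using L by (simp add: G_def)
  have "cov M Y (\<lambda>\<omega>. k (X j \<omega>)) = 2 * L2 * ((\<integral>\<omega>. Y \<omega> * G \<omega> \<partial>M) - (\<integral>\<omega>. Y \<omega> \<partial>M) * ?mG)"
  proof -
    have "Y \<omega> * (2 * L2 * G \<omega>) = (2 * L2) * (Y \<omega> * G \<omega>)" for \<omega> by simp
    then show ?thesis unfolding cov_def kG by (simp only: integral_mult_right_zero) (simp add: algebra_simps)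
  qed
  then have "\<bar>cov M Y (\<lambda>\<omega>. k (X j \<omega>))\<bar> \<le> 2 * L2 * \<delta>"
    using main L by (simp add: abs_mult mult_left_mono)
  also have "\<dots> \<le> (real u * L1 + L2) * (2 * \<delta>)" using L assms(5) by (simp add: distrib_right)
  finally show "\<bar>cov M (\<lambda>\<omega>. h (tuple X u i \<omega>)) (\<lambda>\<omega>. k (X j \<omega>))\<bar> \<le> (real u * L1 + L2) * (2 * \<delta>)"
    by (simp add: Y_def)
qed

lemma eventually_decoupled:
  fixes N :: "'v::euclidean_space \<Rightarrow> real"
  assumes "prob_space M" "is_norm N" "\<And>n. X n \<in> borel_measurable M"
    and "(\<exists>\<eta>. eta_weakly_dependent M N X \<eta> \<and> \<eta> \<in> O(\<lambda>r. exp (- a * real r powr b))) \<or>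
       (phi_tilde_dependent M N X \<and>
        ennreal_bigo (phi_tilde_coeff M N X) (\<lambda>r. exp (- a * real r powr b)))"
  obtains C where "0 < C"
    "\<forall>\<^sub>F r in sequentially. decoupled M N X r (C * exp (- a * real r powr b))"
proof -
  have mono: "decoupled M N X r \<delta>'" if "decoupled M N X r \<delta>" "\<delta> \<le> \<delta>'" for r \<delta> \<delta>'
    unfolding decoupled_def
  proof (intro allI impI)
    fix u :: nat and i :: "nat \<Rightarrow> int" and j :: int and h :: "(nat \<Rightarrow> 'v) \<Rightarrow> real"
      and k :: "'v \<Rightarrow> real" and L1 L2 :: real
    assume *: "strict_mono_on {..<u} i \<and> (\<forall>t<u. i t + int r \<le> j) \<and> 0 < L1 \<and> 0 < L2 \<and>
        h \<in> borel_measurable (Pi\<^sub>M {..<u} (\<lambda>_. borel)) \<and> k \<in> borel_measurable borel \<and>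
        (\<forall>c \<in> {..<u} \<rightarrow>\<^sub>E UNIV. \<bar>h c\<bar> \<le> 1) \<and> (\<forall>c. \<bar>k c\<bar> \<le> 1) \<and>
        (\<forall>c \<in> {..<u} \<rightarrow>\<^sub>E UNIV. \<forall>c' \<in> {..<u} \<rightarrow>\<^sub>E UNIV.
           \<bar>h c - h c'\<bar> \<le> L1 * (\<Sum>t<u. N (c t - c' t))) \<and>
        (\<forall>x y. \<bar>k x - k y\<bar> \<le> L2 * N (x - y))"
    then have "\<bar>cov M (\<lambda>\<omega>. h (tuple X u i \<omega>)) (\<lambda>\<omega>. k (X j \<omega>))\<bar> \<le> (real u * L1 + L2) * \<delta>"
      by (intro decoupledD[OF that(1)]) auto
    also have "\<dots> \<le> (real u * L1 + L2) * \<delta>'" using that(2) * by (intro mult_left_mono) auto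
    finally show "\<bar>cov M (\<lambda>\<omega>. h (tuple X u i \<omega>)) (\<lambda>\<omega>. k (X j \<omega>))\<bar> \<le> (real u * L1 + L2) * \<delta>'" .
  qed
  show ?thesis using assms(4)
  proof (elim disjE exE conjE)
    fix \<eta> assume \<eta>: "eta_weakly_dependent M N X \<eta>" "\<eta> \<in> O(\<lambda>r. exp (- a * real r powr b))"
    from \<eta>(2) obtain C where C: "C > 0"
      "\<forall>\<^sub>F r in sequentially. norm (\<eta> r) \<le> C * norm (exp (- a * real r powr b))"
      by (rule landau_o.bigE)
    from C(2) have "\<forall>\<^sub>F r in sequentially. decoupled M N X r (C * exp (- a * real r powr b))"
      by eventually_elim (auto intro: mono[OF decoupled_if_eta[OF assms(1,2) \<eta>(1)]])
    with C(1) show ?thesis by (rule that)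
  next
    assume "ennreal_bigo (phi_tilde_coeff M N X) (\<lambda>r. exp (- a * real r powr b))"
    then obtain C where C: "\<forall>\<^sub>F r in sequentially. phi_tilde_coeff M N X r \<le> ennreal (C * exp (- a * real r powr b))"
      unfolding ennreal_bigo_def by blast
    have "\<forall>\<^sub>F r in sequentially. decoupled M N X r (2 * (\<bar>C\<bar> + 1) * exp (- a * real r powr b))"
      using C
    proof eventually_elim
      case (elim r)
      also have "ennreal (C * exp (- a * real r powr b)) \<le> ennreal ((\<bar>C\<bar> + 1) * exp (- a * real r powr b))"
        by (intro ennreal_leI mult_right_mono) auto
      finally show ?case
        using decoupled_if_phi[where M = M and N = N and X = X, OF assms(1-3), where r = r and \<delta> = "(\<bar>C\<bar> + 1) * exp (- a * real r powr b)"]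
        by (simp only: mult.assoc) simp
    qed
    then show ?thesis by (rule that[rotated]) simp
  qed
qed

section \<open>A tail bound for sums of weakly dependent observations\<close>

text \<open>One step of the Chernoff recursion. Integrating the step inequality with
  \<open>x = \<theta> * (S - T)\<close> and \<open>y = \<theta> * \<zeta> (X j)\<close>, decoupling factorises the two correction terms: the
  linear one vanishes since \<open>\<zeta> (X j)\<close> is centred, and the quadratic one is the current moment times
  the variance. As both test functions are bounded by one and \<open>\<theta> * L\<close>-Lipschitz up to constants,
  the decoupling errors are additive and grow only polynomially with the number of summands.\<close>

lemma logistic_moment_step:
  fixes N :: "'v::euclidean_space \<Rightarrow> real" and \<zeta> :: "'v \<Rightarrow> real"
  assumes "prob_space M" "is_norm N" and X: "\<And>n. X n \<in> borel_measurable M"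
    and dec: "decoupled M N X r \<delta>"
    and lip: "\<And>x y. \<bar>\<zeta> x - \<zeta> y\<bar> \<le> L * N (x - y)" and L: "0 < L"
    and bd: "\<And>x. \<bar>\<theta> * \<zeta> x\<bar> \<le> 1" and \<theta>: "0 < \<theta>"
    and i: "strict_mono_on {..<u} i" "\<And>t. t < u \<Longrightarrow> i t + int r \<le> j"
    and mean: "(\<integral>\<omega>. \<zeta> (X j \<omega>) \<partial>M) = 0" and var: "(\<integral>\<omega>. (\<zeta> (X j \<omega>))\<^sup>2 \<partial>M) \<le> V"
  defines "S \<equiv> \<lambda>\<omega>. \<Sum>t<u. \<zeta> (X (i t) \<omega>)"
  shows "(\<integral>\<omega>. logistic (\<theta> * (S \<omega> + \<zeta> (X j \<omega>) - T)) \<partial>M)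
    \<le> (1 + \<theta>\<^sup>2 * V) * (\<integral>\<omega>. logistic (\<theta> * (S \<omega> - T)) \<partial>M) + 2 * (real u + 2) * (\<theta> * L) * \<delta>"
proof -
  interpret prob_space M by fact
  note [measurable] = X
  have \<zeta>m [measurable]: "\<zeta> \<in> borel_measurable borel"
    by (rule borel_measurable_if_lipschitz[OF assms(2) lip])
  have \<theta>L: "0 < \<theta> * L" using \<theta> L by simp
  define hs where "hs = (\<lambda>c :: nat \<Rightarrow> 'v. \<theta> * ((\<Sum>t<u. \<zeta> (c t)) - T))"
  have hsm [measurable]: "hs \<in> borel_measurable (Pi\<^sub>M {..<u} (\<lambda>_. borel))"
    unfolding hs_def by measurable
  have hsL: "\<bar>hs c - hs c'\<bar> \<le> \<theta> * L * (\<Sum>t<u. N (c t - c' t))" for c c'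
  proof -
    have "\<bar>hs c - hs c'\<bar> = \<theta> * \<bar>\<Sum>t<u. \<zeta> (c t) - \<zeta> (c' t)\<bar>"
      using \<theta> by (simp add: hs_def right_diff_distrib[symmetric] abs_mult sum_subtractf)
    also have "\<dots> \<le> \<theta> * (\<Sum>t<u. \<bar>\<zeta> (c t) - \<zeta> (c' t)\<bar>)"
      using \<theta> by (intro mult_left_mono sum_abs) auto
    also have "\<dots> \<le> \<theta> * (\<Sum>t<u. L * N (c t - c' t))"
      using \<theta> by (intro mult_left_mono sum_mono lip) auto
    finally show ?thesis by (simp add: sum_distrib_left mult.assoc)
  qed
  have hsX: "hs (tuple X u i \<omega>) = \<theta> * (S \<omega> - T)" for \<omega>
    by (simp add: hs_def S_def tuple_def)
  define W where "W = (\<lambda>\<omega>. logistic (\<theta> * (S \<omega> - T)))"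
  define Y where "Y = (\<lambda>\<omega>. \<theta> * \<zeta> (X j \<omega>))"
  have Sm [measurable]: "S \<in> borel_measurable M" unfolding S_def by measurable
  have Wm [measurable]: "W \<in> borel_measurable M" unfolding W_def by measurable
  have Ym [measurable]: "Y \<in> borel_measurable M" unfolding Y_def by measurable
  have W: "0 \<le> W \<omega>" "W \<omega> \<le> 1" for \<omega>
    using logistic_pos logistic_less_1 by (auto simp: W_def less_imp_le)
  have Yb: "\<bar>Y \<omega>\<bar> \<le> 1" for \<omega> using bd by (simp add: Y_def)
  have Yb2: "(Y \<omega>)\<^sup>2 \<le> 1" for \<omega> using Yb[of \<omega>] by (simp add: abs_square_le_1)
  have WW: "0 \<le> W \<omega> * (1 - W \<omega>)" "W \<omega> * (1 - W \<omega>) \<le> 1" for \<omega>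
    using W[of \<omega>] by (auto intro: mult_le_one)
  have bi: "integrable M g" if "g \<in> borel_measurable M" "\<And>\<omega>. \<bar>g \<omega>\<bar> \<le> 1" for g :: "'a \<Rightarrow> real"
    by (rule integrable_const_bound[of _ 1]) (use that in auto)
  have iW: "integrable M W" using W by (intro bi) (auto simp: abs_le_iff intro: order_trans[of _ 0])
  have iY2: "integrable M (\<lambda>\<omega>. (Y \<omega>)\<^sup>2)" using Yb2 by (intro bi) auto
  have i1: "integrable M (\<lambda>\<omega>. W \<omega> * (1 - W \<omega>) * Y \<omega>)"
  proof (rule bi)
    fix \<omega>
    have "\<bar>W \<omega> * (1 - W \<omega>)\<bar> * \<bar>Y \<omega>\<bar> \<le> 1" using WW[of \<omega>] Yb[of \<omega>] by (intro mult_le_one) auto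
    then show "\<bar>W \<omega> * (1 - W \<omega>) * Y \<omega>\<bar> \<le> 1" by (simp add: abs_mult)
  qed measurable
  have i2: "integrable M (\<lambda>\<omega>. W \<omega> * (Y \<omega>)\<^sup>2)"
    using W Yb2 by (intro bi) (auto simp: abs_mult intro!: mult_le_one)
  have EY: "(\<integral>\<omega>. Y \<omega> \<partial>M) = 0" using mean by (simp add: Y_def)
  have EY2: "(\<integral>\<omega>. (Y \<omega>)\<^sup>2 \<partial>M) \<le> \<theta>\<^sup>2 * V"
    using var by (simp add: Y_def power_mult_distrib mult_left_mono)
  have c1: "\<bar>cov M (\<lambda>\<omega>. W \<omega> * (1 - W \<omega>)) Y\<bar> \<le> (real u * (\<theta> * L) + \<theta> * L) * \<delta>"
  proof -
    have "\<bar>cov M (\<lambda>\<omega>. (\<lambda>c. logistic (hs c) * (1 - logistic (hs c))) (tuple X u i \<omega>))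
        (\<lambda>\<omega>. (\<lambda>x. \<theta> * \<zeta> x) (X j \<omega>))\<bar> \<le> (real u * (\<theta> * L) + \<theta> * L) * \<delta>"
    proof (rule decoupledD[OF dec i \<theta>L \<theta>L])
      fix c c' :: "nat \<Rightarrow> 'v"
      show "\<bar>logistic (hs c) * (1 - logistic (hs c))\<bar> \<le> 1"
        using logistic_pos[of "hs c"] logistic_less_1[of "hs c"]
        by (auto simp: abs_mult intro!: mult_le_one)
      show "\<bar>logistic (hs c) * (1 - logistic (hs c)) - logistic (hs c') * (1 - logistic (hs c'))\<bar>
          \<le> \<theta> * L * (\<Sum>t<u. N (c t - c' t))"
        by (rule order_trans[OF logistic_bell_lipschitz hsL])
    next
      fix x y
      show "\<bar>\<theta> * \<zeta> x - \<theta> * \<zeta> y\<bar> \<le> \<theta> * L * N (x - y)"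
        using lip[of x y] \<theta> by (simp add: right_diff_distrib[symmetric] abs_mult)
    qed (use bd in \<open>simp_all, measurable\<close>)
    then show ?thesis by (simp add: hsX W_def Y_def)
  qed
  have c2: "\<bar>cov M W (\<lambda>\<omega>. (Y \<omega>)\<^sup>2)\<bar> \<le> (real u * (\<theta> * L) + 2 * (\<theta> * L)) * \<delta>"
  proof -
    have "\<bar>cov M (\<lambda>\<omega>. (\<lambda>c. logistic (hs c)) (tuple X u i \<omega>))
        (\<lambda>\<omega>. (\<lambda>x. (\<theta> * \<zeta> x)\<^sup>2) (X j \<omega>))\<bar> \<le> (real u * (\<theta> * L) + 2 * (\<theta> * L)) * \<delta>"
    proof (rule decoupledD[OF dec i \<theta>L])
      fix c c' :: "nat \<Rightarrow> 'v"
      show "\<bar>logistic (hs c)\<bar> \<le> 1"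
        using logistic_pos[of "hs c"] logistic_less_1[of "hs c"] by auto
      show "\<bar>logistic (hs c) - logistic (hs c')\<bar> \<le> \<theta> * L * (\<Sum>t<u. N (c t - c' t))"
        by (rule order_trans[OF logistic_lipschitz hsL])
    next
      fix x y
      have "\<bar>(\<theta> * \<zeta> x)\<^sup>2 - (\<theta> * \<zeta> y)\<^sup>2\<bar> = \<bar>\<theta> * \<zeta> x + \<theta> * \<zeta> y\<bar> * (\<theta> * \<bar>\<zeta> x - \<zeta> y\<bar>)"
        using \<theta> by (simp add: abs_mult[symmetric] power2_eq_square algebra_simps abs_mult_pos')
      also have "\<dots> \<le> 2 * (\<theta> * (L * N (x - y)))"
        using bd[of x] bd[of y] \<theta> lip[of x y] by (intro mult_mono mult_nonneg_nonneg) auto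
      finally show "\<bar>(\<theta> * \<zeta> x)\<^sup>2 - (\<theta> * \<zeta> y)\<^sup>2\<bar> \<le> 2 * (\<theta> * L) * N (x - y)" by (simp add: mult.assoc)
      show "\<bar>(\<theta> * \<zeta> x)\<^sup>2\<bar> \<le> 1" using bd[of x] by (simp add: abs_square_le_1)
    qed (use \<theta>L in \<open>simp_all, measurable\<close>)
    then show ?thesis by (simp add: hsX W_def Y_def)
  qed
  have "(\<integral>\<omega>. logistic (\<theta> * (S \<omega> + \<zeta> (X j \<omega>) - T)) \<partial>M)
      \<le> (\<integral>\<omega>. W \<omega> + W \<omega> * (1 - W \<omega>) * Y \<omega> + W \<omega> * (Y \<omega>)\<^sup>2 \<partial>M)"
  proof (rule integral_mono)
    show "integrable M (\<lambda>\<omega>. logistic (\<theta> * (S \<omega> + \<zeta> (X j \<omega>) - T)))"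
      by (rule bi) (use logistic_pos logistic_less_1 in \<open>auto simp: less_imp_le abs_of_pos\<close>)
    show "integrable M (\<lambda>\<omega>. W \<omega> + W \<omega> * (1 - W \<omega>) * Y \<omega> + W \<omega> * (Y \<omega>)\<^sup>2)"
      using iW i1 i2 by simp
    fix \<omega>
    have "\<theta> * (S \<omega> + \<zeta> (X j \<omega>) - T) = \<theta> * (S \<omega> - T) + Y \<omega>"
      by (simp add: Y_def algebra_simps)
    then show "logistic (\<theta> * (S \<omega> + \<zeta> (X j \<omega>) - T))
        \<le> W \<omega> + W \<omega> * (1 - W \<omega>) * Y \<omega> + W \<omega> * (Y \<omega>)\<^sup>2"
      using logistic_step[OF Yb[of \<omega>], of "\<theta> * (S \<omega> - T)"] by (simp add: W_def)
  qed
  also have "\<dots> = (\<integral>\<omega>. W \<omega> \<partial>M) + (\<integral>\<omega>. W \<omega> * (1 - W \<omega>) * Y \<omega> \<partial>M) + (\<integral>\<omega>. W \<omega> * (Y \<omega>)\<^sup>2 \<partial>M)"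
    using iW i1 i2 by simp
  also have "\<dots> = (\<integral>\<omega>. W \<omega> \<partial>M) + cov M (\<lambda>\<omega>. W \<omega> * (1 - W \<omega>)) Y
      + (cov M W (\<lambda>\<omega>. (Y \<omega>)\<^sup>2) + (\<integral>\<omega>. W \<omega> \<partial>M) * (\<integral>\<omega>. (Y \<omega>)\<^sup>2 \<partial>M))"
    by (simp add: cov_def EY)
  also have "\<dots> \<le> (\<integral>\<omega>. W \<omega> \<partial>M) + (real u * (\<theta> * L) + \<theta> * L) * \<delta>
      + ((real u * (\<theta> * L) + 2 * (\<theta> * L)) * \<delta> + (\<integral>\<omega>. W \<omega> \<partial>M) * (\<theta>\<^sup>2 * V))"
    using c1 c2 EY2 W by (intro add_mono mult_left_mono integral_nonneg_AE) auto
  also have "\<dots> = (1 + \<theta>\<^sup>2 * V) * (\<integral>\<omega>. W \<omega> \<partial>M) + (2 * real u + 3) * (\<theta> * L) * \<delta>"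
    by (simp add: algebra_simps)
  also have "\<dots> \<le> (1 + \<theta>\<^sup>2 * V) * (\<integral>\<omega>. W \<omega> \<partial>M) + 2 * (real u + 2) * (\<theta> * L) * \<delta>"
  proof -
    have "0 \<le> (real u * (\<theta> * L) + \<theta> * L) * \<delta>" using c1 abs_ge_zero order_trans by blast
    then have "0 \<le> \<delta>" using \<theta>L
      by (metis add_nonneg_pos less_imp_le mult_nonneg_nonneg of_nat_0_le_iff zero_le_mult_iff not_le)
    then show ?thesis using \<theta>L by (intro add_left_mono mult_right_mono) auto
  qed
  finally show ?thesis by (simp add: W_def)
qed

text \<open>Iterating the step. For an exponential in place of the logistic function, the decoupling error
  would be multiplied by the supremum of the test function, which is exponential in the number of
  summands; here that supremum is one.\<close>

lemma logistic_moment_bound: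
  fixes N :: "'v::euclidean_space \<Rightarrow> real" and \<zeta> :: "'v \<Rightarrow> real"
  assumes "prob_space M" "is_norm N" and X: "\<And>n. X n \<in> borel_measurable M"
    and dec: "decoupled M N X r \<delta>" and \<delta>: "0 \<le> \<delta>"
    and lip: "\<And>x y. \<bar>\<zeta> x - \<zeta> y\<bar> \<le> L * N (x - y)" and L: "0 < L"
    and bd: "\<And>x. \<bar>\<theta> * \<zeta> x\<bar> \<le> 1" and \<theta>: "0 < \<theta>"
    and i: "strict_mono i" "\<And>t t'. t < t' \<Longrightarrow> i t + int r \<le> i t'"
    and mean: "\<And>j. (\<integral>\<omega>. \<zeta> (X j \<omega>) \<partial>M) = 0" and var: "\<And>j. (\<integral>\<omega>. (\<zeta> (X j \<omega>))\<^sup>2 \<partial>M) \<le> V"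
  shows "(\<integral>\<omega>. logistic (\<theta> * ((\<Sum>t<J. \<zeta> (X (i t) \<omega>)) - T)) \<partial>M)
    \<le> exp (real J * (\<theta>\<^sup>2 * V)) * (exp (- \<theta> * T) + 2 * real J * (real J + 2) * (\<theta> * L) * \<delta>)"
proof -
  interpret prob_space M by fact
  define E where "E = 2 * (real J + 2) * (\<theta> * L) * \<delta>"
  have E: "0 \<le> E" using \<theta> L \<delta> by (simp add: E_def)
  have "0 \<le> (\<integral>\<omega>. (\<zeta> (X 0 \<omega>))\<^sup>2 \<partial>M)" by (rule integral_nonneg_AE) auto
  then have V: "0 \<le> V" using var[of 0] by linarith
  define B where "B = 1 + \<theta>\<^sup>2 * V"
  have B: "1 \<le> B" using V by (simp add: B_def)
  have ind: "(\<integral>\<omega>. logistic (\<theta> * ((\<Sum>t<u. \<zeta> (X (i t) \<omega>)) - T)) \<partial>M)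
      \<le> B ^ u * (exp (- \<theta> * T) + real u * E)" if "u \<le> J" for u
    using that
  proof (induction u)
    case 0
    then show ?case using logistic_le_exp[of "- (\<theta> * T)"] by (simp add: prob_space)
  next
    case (Suc u)
    have "(\<integral>\<omega>. logistic (\<theta> * ((\<Sum>t<Suc u. \<zeta> (X (i t) \<omega>)) - T)) \<partial>M)
      \<le> B * (\<integral>\<omega>. logistic (\<theta> * ((\<Sum>t<u. \<zeta> (X (i t) \<omega>)) - T)) \<partial>M) + 2 * (real u + 2) * (\<theta> * L) * \<delta>"
      using logistic_moment_step[OF assms(1,2) X dec lip L bd \<theta> _ _ mean var, of u i "i u" T] i
      by (simp add: B_def strict_mono_on_def strict_mono_def)
    also have "\<dots> \<le> B * (B ^ u * (exp (- \<theta> * T) + real u * E)) + B ^ Suc u * E"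
    proof (intro add_mono mult_left_mono)
      have "2 * (real u + 2) * (\<theta> * L) * \<delta> \<le> E"
        using Suc.prems \<theta> L \<delta> by (auto simp: E_def intro!: mult_right_mono)
      also have "1 * E \<le> B ^ Suc u * E" using B E by (intro mult_right_mono one_le_power) auto
      finally show "2 * (real u + 2) * (\<theta> * L) * \<delta> \<le> B ^ Suc u * E" by simp
    qed (use Suc B in auto)
    also have "\<dots> = B ^ Suc u * (exp (- \<theta> * T) + real (Suc u) * E)" by (simp add: algebra_simps)
    finally show ?case .
  qed
  have "B ^ J \<le> exp (\<theta>\<^sup>2 * V) ^ J"
    unfolding B_def using V exp_ge_add_one_self[of "\<theta>\<^sup>2 * V"] by (intro power_mono) auto
  then have "B ^ J \<le> exp (real J * (\<theta>\<^sup>2 * V))" by (simp add: exp_of_nat_mult)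
  then have "B ^ J * (exp (- \<theta> * T) + real J * E) \<le> exp (real J * (\<theta>\<^sup>2 * V)) * (exp (- \<theta> * T) + real J * E)"
    using E by (intro mult_right_mono) auto
  then show ?thesis using ind[of J] by (simp add: E_def mult.assoc mult.left_commute)
qed

text \<open>Markov's inequality: beyond the threshold, the logistic function is at least one half.\<close>

lemma sparse_sum_tail:
  fixes N :: "'v::euclidean_space \<Rightarrow> real" and \<zeta> :: "'v \<Rightarrow> real"
  assumes "prob_space M" "is_norm N" and X: "\<And>n. X n \<in> borel_measurable M"
    and dec: "decoupled M N X r \<delta>" and \<delta>: "0 \<le> \<delta>"
    and lip: "\<And>x y. \<bar>\<zeta> x - \<zeta> y\<bar> \<le> L * N (x - y)" and L: "0 < L"
    and bd: "\<And>x. \<bar>\<theta> * \<zeta> x\<bar> \<le> 1" and \<theta>: "0 < \<theta>"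
    and i: "strict_mono i" "\<And>t t'. t < t' \<Longrightarrow> i t + int r \<le> i t'"
    and mean: "\<And>j. (\<integral>\<omega>. \<zeta> (X j \<omega>) \<partial>M) = 0" and var: "\<And>j. (\<integral>\<omega>. (\<zeta> (X j \<omega>))\<^sup>2 \<partial>M) \<le> V"
  shows "measure M {\<omega> \<in> space M. T \<le> \<bar>\<Sum>t<J. \<zeta> (X (i t) \<omega>)\<bar>}
    \<le> 4 * exp (real J * (\<theta>\<^sup>2 * V)) * (exp (- \<theta> * T) + 2 * real J * (real J + 2) * (\<theta> * L) * \<delta>)"
proof -
  interpret prob_space M by fact
  note [measurable] = X
  let ?B = "exp (real J * (\<theta>\<^sup>2 * V)) * (exp (- \<theta> * T) + 2 * real J * (real J + 2) * (\<theta> * L) * \<delta>)"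
  have one: "measure M {\<omega> \<in> space M. T \<le> (\<Sum>t<J. \<xi> (X (i t) \<omega>))} \<le> 2 * ?B"
    if \<xi>: "\<And>x y. \<bar>\<xi> x - \<xi> y\<bar> \<le> L * N (x - y)" "\<And>x. \<bar>\<theta> * \<xi> x\<bar> \<le> 1"
      "\<And>j. (\<integral>\<omega>. \<xi> (X j \<omega>) \<partial>M) = 0" "\<And>j. (\<integral>\<omega>. (\<xi> (X j \<omega>))\<^sup>2 \<partial>M) \<le> V" for \<xi> :: "'v \<Rightarrow> real"
  proof -
    have [measurable]: "\<xi> \<in> borel_measurable borel"
      by (rule borel_measurable_if_lipschitz[OF assms(2) \<xi>(1)])
    let ?W = "\<lambda>\<omega>. logistic (\<theta> * ((\<Sum>t<J. \<xi> (X (i t) \<omega>)) - T))"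
    have "measure M {\<omega> \<in> space M. T \<le> (\<Sum>t<J. \<xi> (X (i t) \<omega>))}
        \<le> measure M {\<omega> \<in> space M. 1 / 2 \<le> ?W \<omega>}"
    proof (rule finite_measure_mono)
      show "{\<omega> \<in> space M. T \<le> (\<Sum>t<J. \<xi> (X (i t) \<omega>))} \<subseteq> {\<omega> \<in> space M. 1 / 2 \<le> ?W \<omega>}"
        using \<theta> half_le_logistic by (auto simp del: divide_const_simps le_divide_eq_numeral1 divide_le_eq_numeral1)
    qed measurable
    also have "\<dots> \<le> (\<integral>\<omega>. ?W \<omega> \<partial>M) / (1 / 2)"
      by (rule integral_Markov_inequality_measure[where A = "{}"])
        (auto intro!: integrable_const_bound[of _ 1] simp: logistic_pos logistic_less_1 less_imp_le abs_of_pos)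
    also have "\<dots> \<le> 2 * ?B"
      using logistic_moment_bound[OF assms(1,2) X dec \<delta> \<xi>(1) L \<xi>(2) \<theta> i \<xi>(3,4), of J T] by simp
    finally show ?thesis .
  qed
  have [measurable]: "\<zeta> \<in> borel_measurable borel"
    by (rule borel_measurable_if_lipschitz[OF assms(2) lip])
  have "measure M {\<omega> \<in> space M. T \<le> \<bar>\<Sum>t<J. \<zeta> (X (i t) \<omega>)\<bar>}
      \<le> measure M ({\<omega> \<in> space M. T \<le> (\<Sum>t<J. \<zeta> (X (i t) \<omega>))}
          \<union> {\<omega> \<in> space M. T \<le> (\<Sum>t<J. - \<zeta> (X (i t) \<omega>))})"
    by (rule finite_measure_mono) (auto simp: sum_negf)
  also have "\<dots> \<le> measure M {\<omega> \<in> space M. T \<le> (\<Sum>t<J. \<zeta> (X (i t) \<omega>))}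
          + measure M {\<omega> \<in> space M. T \<le> (\<Sum>t<J. - \<zeta> (X (i t) \<omega>))}"
    by (rule measure_Un_le) measurable
  also have "\<dots> \<le> 2 * ?B + 2 * ?B"
  proof (rule add_mono)
    show "measure M {\<omega> \<in> space M. T \<le> (\<Sum>t<J. \<zeta> (X (i t) \<omega>))} \<le> 2 * ?B"
      by (rule one) (rule lip bd mean var)+
    show "measure M {\<omega> \<in> space M. T \<le> (\<Sum>t<J. - \<zeta> (X (i t) \<omega>))} \<le> 2 * ?B"
      by (rule one) (use lip bd mean var in \<open>auto simp: abs_minus_commute\<close>)
  qed
  finally show ?thesis by simp
qed

lemma sum_residue_classes:
  fixes g :: "nat \<Rightarrow> real"
  assumes "0 < p"
  shows "(\<Sum>i<n. g i) = (\<Sum>s<p. \<Sum>t<(n + p - 1 - s) div p. g (s + t * p))"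
proof -
  have eq: "t < (n + p - 1 - s) div p \<longleftrightarrow> s + t * p < n" if "s < p" for s t
  proof -
    have "t < (n + p - 1 - s) div p \<longleftrightarrow> Suc t * p \<le> n + p - 1 - s"
      using less_eq_div_iff_mult_less_eq[OF assms, of "Suc t"] by (simp add: Suc_le_eq)
    then show ?thesis using that assms by auto
  qed
  have "(\<Sum>i<n. g i) = (\<Sum>(s, t)\<in>(SIGMA s:{..<p}. {..<(n + p - 1 - s) div p}). g (s + t * p))"
    by (rule sum.reindex_bij_witness[where i = "\<lambda>(s, t). s + t * p" and j = "\<lambda>i. (i mod p, i div p)"])
      (use assms in \<open>auto simp: eq[simplified]\<close>)
  also have "\<dots> = (\<Sum>s<p. \<Sum>t<(n + p - 1 - s) div p. g (s + t * p))"
    by (subst sum.Sigma) auto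
  finally show ?thesis .
qed

text \<open>The sum over \<open>1..n\<close> splits into the residue classes modulo \<open>p\<close>; consecutive indices of a
  class are \<open>p\<close> apart, so each class is a sparse sum. If the total exceeds \<open>T\<close>, one of the \<open>p\<close>
  partial sums exceeds \<open>T / p\<close>. Relative to independent summands this loses a factor \<open>p\<close> in the
  variance.\<close>

lemma full_sum_tail:
  fixes N :: "'v::euclidean_space \<Rightarrow> real" and \<zeta> :: "'v \<Rightarrow> real"
  assumes "prob_space M" "is_norm N" and X: "\<And>n. X n \<in> borel_measurable M"
    and dec: "decoupled M N X p \<delta>" and \<delta>: "0 \<le> \<delta>" and p: "0 < p" "p \<le> n"
    and lip: "\<And>x y. \<bar>\<zeta> x - \<zeta> y\<bar> \<le> L * N (x - y)" and L: "0 < L"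
    and bd: "\<And>x. \<bar>\<theta> * \<zeta> x\<bar> \<le> 1" and \<theta>: "0 < \<theta>"
    and mean: "\<And>j. (\<integral>\<omega>. \<zeta> (X j \<omega>) \<partial>M) = 0" and var: "\<And>j. (\<integral>\<omega>. (\<zeta> (X j \<omega>))\<^sup>2 \<partial>M) \<le> V"
  shows "measure M {\<omega> \<in> space M. T \<le> \<bar>\<Sum>i=1..n. \<zeta> (X (int i) \<omega>)\<bar>}
    \<le> 4 * real n * exp (2 * real n / real p * (\<theta>\<^sup>2 * V)) *
       (exp (- \<theta> * (T / real p)) + 2 * real n * (real n + 2) * (\<theta> * L) * \<delta>)"
proof -
  interpret prob_space M by fact
  note [measurable] = X
  have [measurable]: "\<zeta> \<in> borel_measurable borel"
    by (rule borel_measurable_if_lipschitz[OF assms(2) lip])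
  have "0 \<le> (\<integral>\<omega>. (\<zeta> (X 0 \<omega>))\<^sup>2 \<partial>M)" by (rule integral_nonneg_AE) auto
  then have V: "0 \<le> V" using var[of 0] by linarith
  define J where "J = (\<lambda>s. (n + p - 1 - s) div p)"
  define i where "i = (\<lambda>s t. int (s + t * p) + 1)"
  let ?B = "4 * exp (2 * real n / real p * (\<theta>\<^sup>2 * V)) *
       (exp (- \<theta> * (T / real p)) + 2 * real n * (real n + 2) * (\<theta> * L) * \<delta>)"
  define A where "A = (\<lambda>s. {\<omega> \<in> space M. T / real p \<le> \<bar>\<Sum>t<J s. \<zeta> (X (i s t) \<omega>)\<bar>})"
  have A [measurable]: "A s \<in> sets M" for s unfolding A_def by measurable
  have Jn: "real (J s) \<le> 2 * real n / real p" "J s \<le> n" for s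
  proof -
    have "J s * p \<le> n + p - 1 - s" unfolding J_def by simp
    then have "J s * p \<le> 2 * n" using p by linarith
    then have "real (J s) * real p \<le> 2 * real n" by (metis of_nat_le_iff of_nat_mult of_nat_numeral)
    then show "real (J s) \<le> 2 * real n / real p" using p by (simp add: pos_le_divide_eq)
    show "J s \<le> n"
    proof (rule ccontr)
      assume "\<not> J s \<le> n"
      then have "Suc n * p \<le> J s * p" by (intro mult_le_mono1) simp
      then have "p + n * p \<le> J s * p" by simp
      moreover have "n \<le> n * p" using p by simp
      ultimately show False using \<open>J s * p \<le> n + p - 1 - s\<close> p by linarith
    qed
  qed
  have mA: "measure M (A s) \<le> ?B" for s
  proof -
    have "measure M (A s) \<le> 4 * exp (real (J s) * (\<theta>\<^sup>2 * V)) *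
        (exp (- \<theta> * (T / real p)) + 2 * real (J s) * (real (J s) + 2) * (\<theta> * L) * \<delta>)"
      unfolding A_def
    proof (rule sparse_sum_tail[OF assms(1,2) X dec \<delta> lip L bd \<theta> _ _ mean var])
      show "strict_mono (i s)"
      proof (rule strict_monoI)
        fix t t' :: nat assume "t < t'"
        then have "s + t * p < s + t' * p" using p by simp
        then show "i s t < i s t'" unfolding i_def by linarith
      qed
      show "i s t + int p \<le> i s t'" if "t < t'" for t t'
      proof -
        have "Suc t * p \<le> t' * p" using that by (intro mult_le_mono1) simp
        then have "s + t * p + p \<le> s + t' * p" by simp
        then show ?thesis unfolding i_def by linarith
      qed
    qed
    also have "\<dots> \<le> ?B"
    proof -
      have e: "exp (real (J s) * (\<theta>\<^sup>2 * V)) \<le> exp (2 * real n / real p * (\<theta>\<^sup>2 * V))"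
        unfolding exp_le_cancel_iff using Jn V by (intro mult_right_mono) auto
      have f: "2 * real (J s) * (real (J s) + 2) * (\<theta> * L) * \<delta> \<le> 2 * real n * (real n + 2) * (\<theta> * L) * \<delta>"
        using Jn(2)[of s] \<theta> L \<delta> by (intro mult_right_mono mult_mono) auto
      have g: "0 \<le> 2 * real (J s) * (real (J s) + 2) * (\<theta> * L) * \<delta>" using \<theta> L \<delta> by simp
      show ?thesis
        by (rule mult_mono[OF mult_left_mono[OF e] add_left_mono[OF f]])
          (use add_nonneg_nonneg[OF exp_ge_zero g] in auto)
    qed
    finally show ?thesis .
  qed
  have "{\<omega> \<in> space M. T \<le> \<bar>\<Sum>i=1..n. \<zeta> (X (int i) \<omega>)\<bar>} \<subseteq> (\<Union>s<p. A s)"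
  proof (rule subsetI, rule ccontr)
    fix \<omega> assume \<omega>: "\<omega> \<in> {\<omega> \<in> space M. T \<le> \<bar>\<Sum>i=1..n. \<zeta> (X (int i) \<omega>)\<bar>}" and n: "\<omega> \<notin> (\<Union>s<p. A s)"
    have "(\<Sum>i=1..n. \<zeta> (X (int i) \<omega>)) = (\<Sum>i<n. \<zeta> (X (int i + 1) \<omega>))"
      by (rule sum.reindex_bij_witness[where i = Suc and j = "\<lambda>i. i - 1"]) (auto simp: add.commute)
    also have "\<dots> = (\<Sum>s<p. \<Sum>t<J s. \<zeta> (X (i s t) \<omega>))"
      unfolding J_def i_def by (rule sum_residue_classes[OF p(1)])
    finally have "T \<le> \<bar>\<Sum>s<p. \<Sum>t<J s. \<zeta> (X (i s t) \<omega>)\<bar>" using \<omega> by simp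
    also have "\<dots> \<le> (\<Sum>s<p. \<bar>\<Sum>t<J s. \<zeta> (X (i s t) \<omega>)\<bar>)" by (rule sum_abs)
    also have "\<dots> < (\<Sum>s<p. T / real p)"
      using n \<omega> p by (intro sum_strict_mono) (auto simp: A_def not_le)
    also have "\<dots> = T" using p by simp
    finally show False by simp
  qed
  then have "measure M {\<omega> \<in> space M. T \<le> \<bar>\<Sum>i=1..n. \<zeta> (X (int i) \<omega>)\<bar>} \<le> measure M (\<Union>s<p. A s)"
    by (intro finite_measure_mono) auto
  also have "\<dots> \<le> (\<Sum>s<p. measure M (A s))"
    by (rule measure_UNION_le) auto
  also have "\<dots> \<le> (\<Sum>s<p. ?B)" by (intro sum_mono mA)
  also have "\<dots> = real p * ?B" by simp
  also have "\<dots> \<le> real n * ?B" using p \<theta> L \<delta> by (intro mult_right_mono mult_nonneg_nonneg add_nonneg_nonneg) auto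
  finally show ?thesis by (simp add: mult.assoc mult.left_commute)
qed

section \<open>Bandwidth and rate\<close>

text \<open>The bandwidth balances the bias \<open>m powr (- \<rho> / d)\<close> against the stochastic error, whose square is
  \<open>m * ln n powr (2 * (b + 1) / b) / n\<close>; at the balance point both are equal to the rate. The maximum with one keeps the bandwidth
  positive where the logarithm vanishes; it is inactive for large \<open>n\<close>.\<close>

definition rate :: "real \<Rightarrow> real \<Rightarrow> real \<Rightarrow> nat \<Rightarrow> real" where
  "rate b \<rho> d n = (ln (real n) powr (2 * (b + 1) / b) / real n) powr (\<rho> / (d + 2 * \<rho>))"

definition bandwidth :: "real \<Rightarrow> real \<Rightarrow> real \<Rightarrow> nat \<Rightarrow> real" where
  "bandwidth b \<rho> d n = max 1 ((real n / ln (real n) powr (2 * (b + 1) / b)) powr (d / (d + 2 * \<rho>)))"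

lemma bandwidth_ge_1: "1 \<le> bandwidth b \<rho> d n"
  by (simp add: bandwidth_def)

lemma eventually_ln_ge: "\<forall>\<^sub>F n in sequentially. c \<le> ln (real n)"
  by real_asymp

lemma eventually_ln_powr_le:
  assumes "0 < c" shows "\<forall>\<^sub>F n in sequentially. ln (real n) powr c \<le> real n"
  using assms by real_asymp

lemma eventually_rate_bandwidth:
  fixes b \<rho> d :: real
  assumes "0 < b" "0 < \<rho>" "0 < d"
  shows "\<forall>\<^sub>F n in sequentially.
    (rate b \<rho> d n)\<^sup>2 = bandwidth b \<rho> d n * ln (real n) powr (2 * (b + 1) / b) / real n \<and>
    1 / real n \<le> rate b \<rho> d n \<and> rate b \<rho> d n \<le> 1 \<and> bandwidth b \<rho> d n \<le> real n \<and>
    bandwidth b \<rho> d n powr (- \<rho> / d) = rate b \<rho> d n"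
proof -
  define \<beta> where "\<beta> = 2 * (b + 1) / b"
  have \<beta>: "0 < \<beta>" using assms by (simp add: \<beta>_def)
  show ?thesis
    using eventually_ln_ge[of 1] eventually_ln_powr_le[OF \<beta>] eventually_gt_at_top[of 1]
  proof eventually_elim
    case (elim n)
    define q where "q = ln (real n) powr \<beta> / real n"
    have L: "1 \<le> ln (real n) powr \<beta>" using elim \<beta> by (intro ge_one_powr_ge_zero) auto
    have q: "0 < q" "q \<le> 1" "1 / real n \<le> q" using L elim by (auto simp: q_def divide_right_mono)
    have iq: "real n / ln (real n) powr \<beta> = 1 / q" using L elim by (simp add: q_def)
    let ?D = "d + 2 * \<rho>"
    have D: "0 < ?D" using assms by simp
    have m: "bandwidth b \<rho> d n = q powr (- (d / ?D))"
    proof -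
      have "(1 / q) powr (d / ?D) = q powr (- (d / ?D))"
        using q by (simp add: powr_minus powr_divide inverse_eq_divide)
      moreover have "1 \<le> (1 / q) powr (d / ?D)"
        using q D assms by (intro ge_one_powr_ge_zero) auto
      ultimately show ?thesis using iq by (simp add: bandwidth_def \<beta>_def)
    qed
    have r: "rate b \<rho> d n = q powr (\<rho> / ?D)" by (simp add: rate_def q_def \<beta>_def)
    have "(rate b \<rho> d n)\<^sup>2 = q powr (2 * \<rho> / ?D)"
      by (simp add: r power2_eq_square powr_add[symmetric])
    also have "2 * \<rho> / ?D = - (d / ?D) + 1" using D by (simp add: field_simps)
    also have "q powr (- (d / ?D) + 1) = bandwidth b \<rho> d n * q" using q by (simp only: powr_add) (simp add: m)
    finally have 1: "(rate b \<rho> d n)\<^sup>2 = bandwidth b \<rho> d n * q" .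
    have "1 / real n \<le> q powr 1" using q by simp
    also have "\<dots> \<le> rate b \<rho> d n" unfolding r using q D assms by (intro powr_mono') auto
    finally have 2: "1 / real n \<le> rate b \<rho> d n" .
    have 3: "rate b \<rho> d n \<le> 1" unfolding r using q D assms by (intro powr_le1) auto
    have "bandwidth b \<rho> d n \<le> (1 / q) powr 1"
    proof -
      have "bandwidth b \<rho> d n \<le> q powr (- 1)"
        unfolding m using q D assms by (intro powr_mono') auto
      then show ?thesis using q by (simp add: powr_minus_divide)
    qed
    also have "\<dots> \<le> real n" using q elim by (simp add: field_simps)
    finally have 4: "bandwidth b \<rho> d n \<le> real n" .
    have 5: "bandwidth b \<rho> d n powr (- \<rho> / d) = rate b \<rho> d n"
      unfolding m r using assms by (simp add: powr_powr)
    show ?case using 1 2 3 4 5 by (simp add: q_def \<beta>_def)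
  qed
qed

lemma bandwidth_at_top:
  assumes "0 < b" "0 < \<rho>" "0 < d"
  shows "filterlim (bandwidth b \<rho> d) at_top sequentially"
proof -
  have \<beta>: "0 < 2 * (b + 1) / b" and e: "0 < d / (d + 2 * \<rho>)" using assms by auto
  have "filterlim (\<lambda>n. (real n / ln (real n) powr \<beta>) powr e) at_top sequentially"
    if "0 < \<beta>" "0 < e" for \<beta> e :: real
    using that by real_asymp
  from this[OF \<beta> e] show ?thesis
    by (rule filterlim_at_top_mono) (simp add: bandwidth_def)
qed

text \<open>The spacing of the sparse sums is \<open>ln n powr (2 / b)\<close>, so that dependence of order
  \<open>exp (- a * r powr b)\<close> at distance \<open>r\<close> leaves errors \<open>exp (- a * (ln n)\<^sup>2)\<close>, smaller than any power
  of \<open>n\<close>. The tilt is the Chernoff parameter: it is chosen such that the variance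
  term of the exponent is of order \<open>ln n\<close>, a power of \<open>n\<close> after exponentiation.\<close>

definition gap :: "real \<Rightarrow> nat \<Rightarrow> nat" where
  "gap b n = nat \<lceil>ln (real n) powr (2 / b)\<rceil>"

definition tilt :: "real \<Rightarrow> real \<Rightarrow> real \<Rightarrow> nat \<Rightarrow> real" where
  "tilt b \<rho> d n = sqrt (real (gap b n) * ln (real n) / (real n * bandwidth b \<rho> d n))"

lemma gap_at_top:
  assumes "0 < b" shows "filterlim (gap b) at_top sequentially"
proof -
  have "filterlim (\<lambda>n. ln (real n) powr c) at_top sequentially" if "0 < c" for c
    using that by real_asymp
  then have "filterlim (\<lambda>n. ln (real n) powr (2 / b)) at_top sequentially" using assms by simp
  then have "filterlim (\<lambda>n. nat \<lfloor>ln (real n) powr (2 / b)\<rfloor>) at_top sequentially"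
    by (rule filterlim_compose[OF filterlim_nat_sequentially filterlim_compose[OF filterlim_floor_sequentially]])
  then show ?thesis
    by (rule filterlim_at_top_mono) (simp add: gap_def nat_mono floor_le_ceiling)
qed

text \<open>The logarithmic power of the rate pays for the spacing: the Chernoff exponent of a
  deviation by the rate is at least of order \<open>ln n powr (3 / 2)\<close>, which beats every multiple of
  \<open>ln n\<close>.\<close>

lemma eventually_gap_tilt:
  fixes b \<rho> d :: real
  assumes "0 < b" "0 < \<rho>" "0 < d" "0 < a" and Q: "1 \<le> Q"
  shows "\<forall>\<^sub>F n in sequentially. 0 < gap b n \<and> gap b n \<le> n \<and>
    exp (- a * real (gap b n) powr b) \<le> exp (- a * (ln (real n))\<^sup>2) \<and>
    0 < tilt b \<rho> d n \<and> tilt b \<rho> d n \<le> 1 \<and> tilt b \<rho> d n * (Q * bandwidth b \<rho> d n) \<le> 1 \<and>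
    real n / real (gap b n) * ((tilt b \<rho> d n)\<^sup>2 * bandwidth b \<rho> d n) = ln (real n) \<and>
    sqrt (ln (real n) ^ 3 / 2) \<le> tilt b \<rho> d n * (real n * rate b \<rho> d n / real (gap b n))"
proof -
  have "0 < 2 / b" using assms by simp
  have "\<forall>\<^sub>F n in sequentially. ln (real n) powr c + 1 \<le> real n" if "0 < c" for c
    using that by real_asymp
  from this[OF \<open>0 < 2 / b\<close>] show ?thesis
    using eventually_rate_bandwidth[OF assms(1-3)] eventually_ln_ge[of 1] eventually_ln_ge[of "2 * Q\<^sup>2"]
      eventually_gt_at_top[of 1]
  proof eventually_elim
    case (elim n)
    define L m r p \<theta> where "L = ln (real n)" and "m = bandwidth b \<rho> d n" and "r = rate b \<rho> d n"
      and "p = gap b n" and "\<theta> = tilt b \<rho> d n"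
    have L: "1 \<le> L" "2 * Q\<^sup>2 \<le> L" using elim by (auto simp: L_def)
    have n: "1 < real n" using elim by simp
    have m: "1 \<le> m" by (simp add: m_def bandwidth_ge_1)
    have L2b: "1 \<le> L powr (2 / b)" using L assms by (intro ge_one_powr_ge_zero) auto
    have p_low: "L powr (2 / b) \<le> real p" unfolding p_def gap_def L_def by linarith
    have p_up: "real p \<le> L powr (2 / b) + 1"
    proof -
      have "0 \<le> \<lceil>L powr (2 / b)\<rceil>" using L2b by linarith
      then show ?thesis unfolding p_def gap_def L_def[symmetric] by (simp add: of_nat_nat)
    qed
    have p: "0 < p" using p_low L2b by (cases p) auto
    have pn: "p \<le> n" using p_up elim(1) by (simp add: L_def)
    have p2: "real p \<le> 2 * L powr (2 / b)" using p_up L2b by linarith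
    have r2: "r\<^sup>2 = m * L powr (2 + 2 / b) / real n"
    proof -
      have "2 * (b + 1) / b = 2 + 2 / b" using assms by (simp add: field_simps)
      then show ?thesis using elim(2) by (simp add: r_def m_def L_def)
    qed
    have Lsplit: "L powr (2 + 2 / b) = L\<^sup>2 * L powr (2 / b)" using L by (simp add: powr_add)
    have r: "0 \<le> r" "r \<le> 1" using elim(2) by (auto simp: r_def rate_def)
    have \<theta>2: "\<theta>\<^sup>2 = real p * L / (real n * m)"
      unfolding \<theta>_def tilt_def p_def[symmetric] L_def[symmetric] m_def[symmetric]
      using L m by (intro real_sqrt_pow2) auto
    have \<theta>: "0 < \<theta>"
      unfolding \<theta>_def tilt_def p_def[symmetric] L_def[symmetric] m_def[symmetric]
      using L m p n by (intro real_sqrt_gt_zero divide_pos_pos mult_pos_pos) auto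
    have "exp (- a * real p powr b) \<le> exp (- a * L\<^sup>2)"
    proof -
      have "L\<^sup>2 = (L powr (2 / b)) powr b" using L assms by (simp add: powr_powr)
      also have "\<dots> \<le> real p powr b" using p_low assms by (intro powr_mono2) auto
      finally show ?thesis using assms by (simp add: mult_left_mono)
    qed
    moreover have small: "\<theta> * (Q * m) \<le> 1"
    proof -
      have "(\<theta> * (Q * m))\<^sup>2 = real p * L / (real n * m) * (Q\<^sup>2 * m\<^sup>2)"
        by (simp add: power_mult_distrib \<theta>2)
      also have "\<dots> = real p * (L * Q\<^sup>2 * m / real n)"
        using n m by (simp add: power2_eq_square field_simps)
      also have "\<dots> \<le> 2 * L powr (2 / b) * (L * Q\<^sup>2 * m / real n)"
        using p2 L m by (intro mult_right_mono) auto
      also have "\<dots> = 2 * Q\<^sup>2 * (r\<^sup>2 / L)"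
        unfolding r2 Lsplit using L n by (simp add: power2_eq_square field_simps)
      also have "\<dots> \<le> 2 * Q\<^sup>2 * (1 / L)"
        using r L by (intro mult_left_mono divide_right_mono power_le_one) auto
      also have "\<dots> \<le> 1" using L by simp
      finally show ?thesis using power2_le_imp_le[of "\<theta> * (Q * m)" 1] by simp
    qed
    moreover have "\<theta> \<le> 1"
    proof -
      have "\<theta> * (1 * 1) \<le> \<theta> * (Q * m)" using Q m \<theta> by (intro mult_left_mono mult_mono) auto
      then show ?thesis using small by simp
    qed
    moreover have "real n / real p * (\<theta>\<^sup>2 * m) = L"
      unfolding \<theta>2 using p n m by simp
    moreover have "sqrt (L ^ 3 / 2) \<le> \<theta> * (real n * r / real p)"
    proof -
      have "L ^ 3 / 2 = L * (L\<^sup>2 * L powr (2 / b)) / (2 * L powr (2 / b))"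
        using L2b L by (simp add: power2_eq_square power3_eq_cube)
      also have "\<dots> \<le> L * (L\<^sup>2 * L powr (2 / b)) / real p"
        using p2 p L by (intro divide_left_mono) auto
      also have "\<dots> = (\<theta> * (real n * r / real p))\<^sup>2"
        unfolding power_mult_distrib power_divide \<theta>2 r2 Lsplit
        using n m p by (simp add: power2_eq_square field_simps)
      finally show ?thesis using \<theta> r by (intro real_le_lsqrt) auto
    qed
    ultimately show ?case using p pn \<theta>
      by (simp add: L_def m_def r_def p_def \<theta>_def)
  qed
qed

text \<open>Both error terms are smaller than every power of \<open>n\<close>, while the prefactor is only a power of
  \<open>n\<close>. Any polynomial decay is therefore available for union bounds and for moments.\<close>

lemma eventually_tail_le_powr:
  fixes V C a A :: real
  assumes "0 < a"
  shows "\<forall>\<^sub>F n in sequentially.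
    4 * real n * exp (2 * V * ln (real n)) *
      (exp (- sqrt (ln (real n) ^ 3 / 2)) + C * real n ^ 5 * exp (- a * (ln (real n))\<^sup>2))
    \<le> real n powr (- A)"
proof -
  have 1: "\<forall>\<^sub>F n in sequentially. 4 * real n * exp (2 * V * ln (real n)) * exp (- sqrt (ln (real n) ^ 3 / 2))
      \<le> real n powr (- A) / 2"
    by real_asymp
  have 2: "\<forall>\<^sub>F n in sequentially. 4 * real n * exp (2 * V * ln (real n)) * (\<bar>C\<bar> * real n ^ 5 * exp (- a * (ln (real n))\<^sup>2))
      \<le> real n powr (- A) / 2"
    using assms by real_asymp
  show ?thesis using 1 2
  proof eventually_elim
    case (elim n)
    have "C * real n ^ 5 * exp (- a * (ln (real n))\<^sup>2) \<le> \<bar>C\<bar> * real n ^ 5 * exp (- a * (ln (real n))\<^sup>2)"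
      by (intro mult_right_mono) auto
    then have "4 * real n * exp (2 * V * ln (real n)) * (C * real n ^ 5 * exp (- a * (ln (real n))\<^sup>2))
      \<le> 4 * real n * exp (2 * V * ln (real n)) * (\<bar>C\<bar> * real n ^ 5 * exp (- a * (ln (real n))\<^sup>2))"
      by (intro mult_left_mono) auto
    then show ?case using elim by (simp only: distrib_left)
  qed
qed

section \<open>Kernels with small supports\<close>

lemma not_in_support: "y \<notin> support g \<Longrightarrow> g y = 0"
  using closure_subset[of "{y. g y \<noteq> 0}"] by (auto simp: support_def)

text \<open>The conditions on the kernels imply that \<^term>\<open>K m x\<close> is of size \<open>O(m)\<close> on a set of volume
  \<open>O(1 / m)\<close>: from any point of the support, one reaches a zero of the kernel at a distance of the
  order of the diameter, so the Lipschitz constant times the diameter bounds the kernel; and the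
  support lies in a ball of radius \<open>O(m powr (- 1 / d))\<close>.\<close>

lemma kernel_bounds:
  fixes N :: "'v::euclidean_space \<Rightarrow> real"
  assumes "is_norm N" "small_supports N K" "lipschitz_kernels N K"
  obtains C where "1 \<le> C"
    "\<And>m x y. 0 < m \<Longrightarrow> \<bar>K m x y\<bar> \<le> C * m"
    "\<And>m x x' y. 0 < m \<Longrightarrow> \<bar>K m x y - K m x' y\<bar> \<le> C * m powr (1 + 1 / real DIM('v)) * N (x - x')"
    "\<And>m x x' y. 0 < m \<Longrightarrow> \<bar>K m y x - K m y x'\<bar> \<le> C * m powr (1 + 1 / real DIM('v)) * N (x - x')"
    "\<And>m x. 0 < m \<Longrightarrow> closed (support (K m x)) \<and> emeasure lborel (support (K m x)) \<le> ennreal (C / m)"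
proof -
  define d where "d = real DIM('v)"
  have d: "0 < d" by (simp add: d_def)
  obtain C1 where C1: "\<And>m x S. 0 < m \<Longrightarrow> S \<in> {support (\<lambda>y. K m x y), support (\<lambda>y. K m y x)} \<Longrightarrow>
        compact S \<and> (\<forall>y\<in>S. \<forall>z\<in>S. N (y - z) \<le> C1 * m powr (- 1 / d))"
    using assms(2) unfolding small_supports_def d_def by metis
  obtain C2 where C2: "\<And>m x x' y. 0 < m \<Longrightarrow>
        \<bar>K m x y - K m x' y\<bar> \<le> C2 * m powr (1 + 1 / d) * N (x - x') \<and>
        \<bar>K m y x - K m y x'\<bar> \<le> C2 * m powr (1 + 1 / d) * N (x - x')"
    using assms(3) unfolding lipschitz_kernels_def d_def by metis
  obtain c where c: "0 < c" "\<And>x. norm (x::'v) \<le> c * N x" using norm_le_is_norm[OF assms(1)] by blast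
  note Nn = is_norm_nonneg[OF assms(1)]
  define D where "D = \<bar>C1\<bar> + 1"
  define P where "P = \<bar>C2\<bar> + 1"
  have DP: "1 \<le> D" "1 \<le> P" by (auto simp: D_def P_def)
  have diam: "N (y - z) < D * m powr (- 1 / d)"
    if "0 < m" "y \<in> support (K m x)" "z \<in> support (K m x)" for m x y z
  proof -
    have "N (y - z) \<le> C1 * m powr (- 1 / d)" using C1[of m "support (K m x)" x] that by auto
    also have "\<dots> < D * m powr (- 1 / d)" using that(1) by (intro mult_strict_right_mono) (auto simp: D_def)
    finally show ?thesis .
  qed
  have lipP: "\<bar>K m x y - K m x' y\<bar> \<le> P * m powr (1 + 1 / d) * N (x - x')"
    "\<bar>K m y x - K m y x'\<bar> \<le> P * m powr (1 + 1 / d) * N (x - x')" if "0 < m" for m x x' y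
  proof -
    have "C2 * m powr (1 + 1 / d) * N (x - x') \<le> P * m powr (1 + 1 / d) * N (x - x')"
      by (intro mult_right_mono Nn) (auto simp: P_def)
    then show "\<bar>K m x y - K m x' y\<bar> \<le> P * m powr (1 + 1 / d) * N (x - x')"
      "\<bar>K m y x - K m y x'\<bar> \<le> P * m powr (1 + 1 / d) * N (x - x')"
      using C2[OF that, of x y x'] C2[OF that, of x y x'] by auto
  qed
  obtain e :: 'v where e: "e \<noteq> 0" using nonempty_Basis nonzero_Basis by blast
  have Ne: "0 < N e" by (rule is_norm_pos[OF assms(1) e])
  have bound: "\<bar>K m x y\<bar> \<le> P * D * m" if m: "0 < m" for m x y
  proof (cases "y \<in> support (K m x)")
    case False
    then have "K m x y = 0" by (rule not_in_support)
    then show ?thesis using m DP by simp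
  next
    case True
    \<comment> \<open>A step longer than the diameter of the support leads to a zero of the kernel.\<close>
    define t where "t = D * m powr (- 1 / d)"
    define z where "z = y + (t / N e) *\<^sub>R e"
    have t: "0 < t" using m DP by (simp add: t_def)
    have "N (z - y) = t" using t Ne by (simp add: z_def is_norm_scale[OF assms(1)])
    then have N: "N (y - z) = t" using is_norm_minus_commute[OF assms(1)] by metis
    then have "z \<notin> support (K m x)" using diam[OF m True, of z] by (auto simp: t_def)
    then have "K m x z = 0" by (rule not_in_support)
    then have "\<bar>K m x y\<bar> \<le> P * m powr (1 + 1 / d) * t" using lipP(2)[OF m, of x y z] N by simp
    also have "\<dots> = P * D * (m powr (1 + 1 / d) * m powr (- 1 / d))" by (simp add: t_def)
    also have "m powr (1 + 1 / d) * m powr (- 1 / d) = m" using m by (simp add: powr_add[symmetric])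
    finally show ?thesis .
  qed
  define U where "U = unit_ball_vol d * (c * D) ^ DIM('v)"
  have U: "0 \<le> U" using c DP by (simp add: U_def d_def unit_ball_vol_nonneg)
  have size: "emeasure lborel (support (K m x)) \<le> ennreal (U / m)" if m: "0 < m" for m x
  proof (cases "support (K m x) = {}")
    case False
    then obtain y where y: "y \<in> support (K m x)" by blast
    define t where "t = c * D * m powr (- 1 / d)"
    have t: "0 \<le> t" using c DP by (simp add: t_def)
    have "support (K m x) \<subseteq> cball y t"
    proof
      fix z assume z: "z \<in> support (K m x)"
      have "dist y z \<le> c * N (y - z)" using c by (simp add: dist_norm)
      also have "\<dots> \<le> c * (D * m powr (- 1 / d))"
        using diam[OF m y z] c by (intro mult_left_mono) auto
      finally show "z \<in> cball y t" by (simp add: t_def mult.assoc)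
    qed
    then have "emeasure lborel (support (K m x)) \<le> emeasure lborel (cball y t)"
      by (intro emeasure_mono) auto
    also have "\<dots> = ennreal (unit_ball_vol d * t ^ DIM('v))"
      using t by (simp add: emeasure_cball d_def)
    also have "unit_ball_vol d * t ^ DIM('v) = U * (m powr (- 1 / d)) ^ DIM('v)"
      by (simp add: t_def U_def power_mult_distrib)
    also have "(m powr (- 1 / d)) ^ DIM('v) = (m powr (- 1 / d)) powr d"
      using m by (simp add: d_def powr_realpow)
    also have "\<dots> = m powr (- 1)" using d by (simp only: powr_powr) simp
    also have "\<dots> = 1 / m" using m by (simp add: powr_minus_divide)
    finally show ?thesis by simp
  qed simp
  define C where "C = P * D + U"
  have PD: "1 \<le> P * D" using mult_mono[of 1 P 1 D] DP by simp
  have PPD: "P \<le> P * D" using DP by (simp add: mult_le_cancel_left1)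
  have le: "P \<le> C" "P * D \<le> C" "U \<le> C" "1 \<le> C" using U PD PPD by (auto simp: C_def)
  show ?thesis
  proof (rule that[of C])
    fix m :: real and x x' y assume m: "0 < m"
    have PC: "P * m powr (1 + 1 / d) * N (x - x') \<le> C * m powr (1 + 1 / d) * N (x - x')"
      using le by (intro mult_right_mono Nn) auto
    show "\<bar>K m x y - K m x' y\<bar> \<le> C * m powr (1 + 1 / real DIM('v)) * N (x - x')"
      using lipP(1)[OF m, of x y x'] PC by (simp add: d_def)
    show "\<bar>K m y x - K m y x'\<bar> \<le> C * m powr (1 + 1 / real DIM('v)) * N (x - x')"
      using lipP(2)[OF m, of y x x'] PC by (simp add: d_def)
    show "\<bar>K m x y\<bar> \<le> C * m"
      by (rule order_trans[OF bound[OF m] mult_right_mono[OF le(2)]]) (use m in simp)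
    have "ennreal (U / m) \<le> ennreal (C / m)" using le m by (intro ennreal_leI divide_right_mono) auto
    then show "closed (support (K m x)) \<and> emeasure lborel (support (K m x)) \<le> ennreal (C / m)"
      using size[OF m, of x] by (auto simp: support_def)
  qed (rule le)
qed

lemma expectation_eq_if_same_density:
  fixes f :: "'v::euclidean_space \<Rightarrow> real"
  assumes "\<And>n :: int. distributed M lborel (X n) (\<lambda>x. ennreal (f x))" "\<And>x. 0 \<le> f x"
    and "g \<in> borel_measurable borel"
  shows "(\<integral>\<omega>. g (X i \<omega>) \<partial>M) = (\<integral>\<omega>. (g (X j \<omega>) :: real) \<partial>M)"
  using distributed_integral[OF assms(1), of g i] distributed_integral[OF assms(1), of g j] assms(2,3)
  by simp

text \<open>A bounded density gives the support of \<open>g\<close> a probability proportional to its volume. For a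
  kernel of size \<open>m\<close> on a set of volume \<open>1 / m\<close>, this makes the second moment of order \<open>m\<close> rather
  than \<open>m\<^sup>2\<close>.\<close>

lemma second_moment_le:
  fixes f :: "'v::euclidean_space \<Rightarrow> real" and g :: "'v \<Rightarrow> real"
  assumes "prob_space M" and dens: "distributed M lborel Z (\<lambda>x. ennreal (f x))"
    and f: "\<And>x. f x \<le> B" "0 \<le> B"
    and g: "g \<in> borel_measurable borel" "\<And>y. \<bar>g y\<bar> \<le> b"
    and S: "closed (support g)" "emeasure lborel (support g) \<le> ennreal s" "0 \<le> s"
  shows "(\<integral>\<omega>. (g (Z \<omega>))\<^sup>2 \<partial>M) \<le> b\<^sup>2 * (B * s)"
proof -
  interpret prob_space M by fact
  have [measurable]: "Z \<in> borel_measurable M" using distributed_measurable[OF dens] by simp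
  note [measurable] = g(1)
  have Sm [measurable]: "support g \<in> sets borel" using S(1) by (rule borel_closed)
  let ?E = "Z -` support g \<inter> space M"
  have "emeasure M ?E = (\<integral>\<^sup>+x. ennreal (f x) * indicator (support g) x \<partial>lborel)"
    by (rule distributed_emeasure[OF dens]) simp
  also have "\<dots> \<le> (\<integral>\<^sup>+x. ennreal B * indicator (support g) x \<partial>lborel)"
    by (intro nn_integral_mono mult_right_mono ennreal_leI f) auto
  also have "\<dots> = ennreal B * emeasure lborel (support g)" by (simp add: nn_integral_cmult)
  also have "\<dots> \<le> ennreal B * ennreal s" by (intro mult_left_mono S) auto
  finally have "measure M ?E \<le> B * s"
    using f S by (simp add: ennreal_mult[symmetric] emeasure_eq_measure)
  have "(\<integral>\<omega>. (g (Z \<omega>))\<^sup>2 \<partial>M) \<le> (\<integral>\<omega>. b\<^sup>2 * indicator ?E \<omega> \<partial>M)"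
  proof (rule integral_mono)
    have gb: "(g y)\<^sup>2 \<le> b\<^sup>2" for y using g(2)[of y] by (simp add: abs_le_square_iff[symmetric])
    show "integrable M (\<lambda>\<omega>. (g (Z \<omega>))\<^sup>2)"
      by (rule integrable_const_bound[of _ "b\<^sup>2"]) (use gb in auto)
    show "integrable M (\<lambda>\<omega>. b\<^sup>2 * indicator ?E \<omega>)"
      by (intro integrable_mult_right integrable_real_indicator emeasure_finite)
        (auto simp: less_top[symmetric])
    show "(g (Z \<omega>))\<^sup>2 \<le> b\<^sup>2 * indicator ?E \<omega>" if "\<omega> \<in> space M" for \<omega>
    proof (cases "g (Z \<omega>) = 0")
      case False
      then have "Z \<omega> \<in> support g" using not_in_support by blast
      then show ?thesis using that gb by simp
    qed simp
  qed
  also have "\<dots> = b\<^sup>2 * measure M ?E" by simp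
  also have "\<dots> \<le> b\<^sup>2 * (B * s)" by (intro mult_left_mono) (fact, simp)
  finally show ?thesis .
qed

section \<open>Polynomial nets\<close>

text \<open>Rounding the coordinates down to multiples of \<open>1 / k\<close>.\<close>

lemma polynomial_net:
  fixes N :: "'v::euclidean_space \<Rightarrow> real"
  assumes "is_norm N"
  obtains C c where "0 \<le> C" "0 \<le> c"
    "\<And>k::nat. 0 < k \<Longrightarrow> \<exists>G. finite G \<and> real (card G) \<le> C * real k ^ DIM('v) \<and>
       (\<forall>x. N x \<le> R \<longrightarrow> (\<exists>g\<in>G. N (x - g) \<le> c / real k))"
proof -
  obtain c1 where c1: "0 < c1" "\<And>x. norm (x::'v) \<le> c1 * N x" using norm_le_is_norm[OF assms] by blast
  define Z where "Z = \<lceil>c1 * \<bar>R\<bar>\<rceil> + 1"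
  have "0 \<le> c1 * \<bar>R\<bar>" using c1 by simp
  then have Z: "1 \<le> Z" unfolding Z_def by linarith
  define c where "c = (\<Sum>b\<in>Basis. N (b::'v))"
  show ?thesis
  proof (rule that[of "(2 * real_of_int Z + 1) ^ DIM('v)" c])
    show "0 \<le> (2 * real_of_int Z + 1) ^ DIM('v)" using Z by simp
    show "0 \<le> c" by (simp add: c_def sum_nonneg is_norm_nonneg[OF assms])
    fix k :: nat assume k: "0 < k"
    define point where "point = (\<lambda>z :: 'v \<Rightarrow> int. \<Sum>b\<in>Basis. (real_of_int (z b) / real k) *\<^sub>R b)"
    define I where "I = PiE (Basis :: 'v set) (\<lambda>_. {- (Z * int k)..Z * int k})"
    have finI: "finite I" unfolding I_def by (intro finite_PiE) auto
    have "card (point ` I) \<le> card I" using finI by (rule card_image_le)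
    also have "card I = nat (2 * (Z * int k) + 1) ^ DIM('v)"
      unfolding I_def by (subst card_PiE) (auto simp: algebra_simps)
    finally have "real (card (point ` I)) \<le> real (nat (2 * (Z * int k) + 1)) ^ DIM('v)"
      by (metis of_nat_le_iff of_nat_power)
    also have "real (nat (2 * (Z * int k) + 1)) = 2 * (real_of_int Z * real k) + 1"
      using Z by (simp add: of_nat_nat)
    also have "(2 * (real_of_int Z * real k) + 1) ^ DIM('v) \<le> ((2 * real_of_int Z + 1) * real k) ^ DIM('v)"
      using Z k by (intro power_mono) (auto simp: algebra_simps)
    finally have card: "real (card (point ` I)) \<le> (2 * real_of_int Z + 1) ^ DIM('v) * real k ^ DIM('v)"
      by (simp add: power_mult_distrib)
    have near: "\<exists>g\<in>point ` I. N (x - g) \<le> c / real k" if x: "N x \<le> R" for x :: 'v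
    proof -
      define z where "z = (\<lambda>b\<in>Basis. \<lfloor>real k * (x \<bullet> b)\<rfloor>)"
      have "z b \<in> {- (Z * int k)..Z * int k}" if b: "b \<in> Basis" for b
      proof -
        have "\<bar>x \<bullet> b\<bar> \<le> norm x" using b by (rule Basis_le_norm)
        also have "\<dots> \<le> c1 * \<bar>R\<bar>"
          using c1(2)[of x] mult_left_mono[of "N x" "\<bar>R\<bar>" c1] c1(1) x by linarith
        also have "\<dots> \<le> real_of_int Z" unfolding Z_def by linarith
        finally have "real k * \<bar>x \<bullet> b\<bar> \<le> real k * real_of_int Z" by (intro mult_left_mono) auto
        then have "\<bar>real k * (x \<bullet> b)\<bar> \<le> real_of_int (Z * int k)" by (simp add: abs_mult mult.commute)
        then have "- real_of_int (Z * int k) \<le> real k * (x \<bullet> b)" "real k * (x \<bullet> b) \<le> real_of_int (Z * int k)"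
          by linarith+
        then show ?thesis using b unfolding z_def by (simp add: le_floor_iff floor_le_iff)
      qed
      then have zI: "z \<in> I" unfolding I_def z_def by auto
      have "x - point z = (\<Sum>b\<in>Basis. ((x \<bullet> b) - real_of_int (z b) / real k) *\<^sub>R b)"
        unfolding point_def scaleR_diff_left sum_subtractf by (simp add: euclidean_representation)
      then have "N (x - point z) \<le> (\<Sum>b\<in>Basis. N (((x \<bullet> b) - real_of_int (z b) / real k) *\<^sub>R b))"
        using is_norm_sum[OF assms] by metis
      also have "\<dots> \<le> (\<Sum>b\<in>Basis. (1 / real k) * N (b::'v))"
      proof (rule sum_mono)
        fix b :: 'v assume b: "b \<in> Basis"
        have "\<bar>real k * (x \<bullet> b) - real_of_int (z b)\<bar> \<le> 1" using b unfolding z_def by simp linarith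
        then have "\<bar>(x \<bullet> b) - real_of_int (z b) / real k\<bar> \<le> 1 / real k"
          using k by (simp add: field_simps abs_le_iff)
        then show "N (((x \<bullet> b) - real_of_int (z b) / real k) *\<^sub>R b) \<le> (1 / real k) * N b"
          unfolding is_norm_scale[OF assms] by (intro mult_right_mono is_norm_nonneg[OF assms])
      qed
      also have "\<dots> = c / real k" by (simp add: c_def sum_divide_distrib)
      finally show ?thesis using zI by blast
    qed
    show "\<exists>G. finite G \<and> real (card G) \<le> (2 * real_of_int Z + 1) ^ DIM('v) * real k ^ DIM('v) \<and>
       (\<forall>x. N x \<le> R \<longrightarrow> (\<exists>g\<in>G. N (x - g) \<le> c / real k))"
      by (rule exI[of _ "point ` I"]) (use finI card near in auto)
  qed
qed

section \<open>Fluctuations of the estimator\<close>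

definition fluctuation ::
  "'w measure \<Rightarrow> (real \<Rightarrow> 'v \<Rightarrow> 'v \<Rightarrow> real) \<Rightarrow> (nat \<Rightarrow> real) \<Rightarrow> (int \<Rightarrow> 'w \<Rightarrow> 'v) \<Rightarrow> nat \<Rightarrow> 'w \<Rightarrow> 'v \<Rightarrow> real" where
  "fluctuation M K m X n \<omega> x = estimator K m X n \<omega> x - (\<integral>\<omega>'. estimator K m X n \<omega>' x \<partial>M)"

lemma estimator_abs_le:
  assumes "\<And>y. \<bar>K (m n) x y\<bar> \<le> c" "0 \<le> c"
  shows "\<bar>estimator K m X n \<omega> x\<bar> \<le> c"
proof -
  have "\<bar>\<Sum>i=1..n. K (m n) x (X (int i) \<omega>)\<bar> \<le> (\<Sum>i=1..n. c)"
    by (rule order_trans[OF sum_abs sum_mono]) (rule assms)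
  then show ?thesis using assms(2) by (cases "n = 0") (auto simp: estimator_def field_simps)
qed

lemma estimator_diff_le:
  assumes "\<And>y. \<bar>K (m n) x y - K (m n) x' y\<bar> \<le> c" "0 \<le> c"
  shows "\<bar>estimator K m X n \<omega> x - estimator K m X n \<omega> x'\<bar> \<le> c"
proof -
  have "\<bar>\<Sum>i=1..n. K (m n) x (X (int i) \<omega>) - K (m n) x' (X (int i) \<omega>)\<bar> \<le> (\<Sum>i=1..n. c)"
    by (rule order_trans[OF sum_abs sum_mono]) (rule assms)
  then show ?thesis using assms(2)
    by (cases "n = 0") (auto simp: estimator_def field_simps sum_subtractf diff_divide_distrib[symmetric])
qed

text \<open>The tail bound for the centred kernel \<open>\<zeta> = K m x - E(K m x (X 0))\<close> of size \<open>2 * C * m\<close>,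
  Lipschitz constant \<open>O(m powr (1 + 1 / d))\<close> and variance \<open>O(m)\<close>. All these constants are uniform
  in \<open>x\<close>, hence so is the index from which on the estimate holds.\<close>

lemma pointwise_fluctuation_tail:
  fixes N :: "'v::euclidean_space \<Rightarrow> real" and f :: "'v \<Rightarrow> real"
  defines "d \<equiv> real DIM('v)"
  assumes "prob_space M" "is_norm N" "0 < \<rho>" "0 < a" "0 < b"
    and density: "\<And>n. distributed M lborel (X n) (\<lambda>x. ennreal (f x))"
    and f: "\<And>x. 0 \<le> f x" "\<And>x. f x \<le> B"
    and dec: "\<forall>\<^sub>F r in sequentially. decoupled M N X r (C1 * exp (- a * real r powr b))" and C1: "0 < C1"
    and K: "small_supports N K" "lipschitz_kernels N K"
  shows "\<forall>\<^sub>F n in sequentially. \<forall>x.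
    measure M {\<omega> \<in> space M. rate b \<rho> d n \<le> \<bar>fluctuation M K (bandwidth b \<rho> d) X n \<omega> x\<bar>} \<le> real n powr (- A)"
proof -
  interpret prob_space M by fact
  have Xm [measurable]: "X n \<in> borel_measurable M" for n
    using distributed_measurable[OF density[of n]] by simp
  have d: "1 \<le> d" "0 < d" by (simp_all add: d_def Suc_leI)
  have B: "0 \<le> B" using f[of 0] by linarith
  obtain C where C: "1 \<le> C"
    and Kb: "\<And>m x y. 0 < m \<Longrightarrow> \<bar>K m x y\<bar> \<le> C * m"
    and Kl: "\<And>m x x' y. 0 < m \<Longrightarrow> \<bar>K m y x - K m y x'\<bar> \<le> C * m powr (1 + 1 / d) * N (x - x')"
    and Ks: "\<And>m x. 0 < m \<Longrightarrow> closed (support (K m x)) \<and> emeasure lborel (support (K m x)) \<le> ennreal (C / m)"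
    using kernel_bounds[OF assms(3) K] unfolding d_def by metis
  define V where "V = C\<^sup>2 * (B * C)"
  have "1 \<le> 2 * C" using C by simp
  from eventually_gap_tilt[OF \<open>0 < b\<close> \<open>0 < \<rho>\<close> d(2) \<open>0 < a\<close> this]
    eventually_rate_bandwidth[OF \<open>0 < b\<close> \<open>0 < \<rho>\<close> d(2)]
    eventually_compose_filterlim[OF dec gap_at_top[OF \<open>0 < b\<close>]]
    eventually_tail_le_powr[OF \<open>0 < a\<close>, of V "6 * C * C1" A]
    eventually_gt_at_top[of 1]
  show ?thesis
  proof eventually_elim
    case (elim n)
    define L m r p \<theta> where "L = ln (real n)" and "m = bandwidth b \<rho> d n" and "r = rate b \<rho> d n"
      and "p = gap b n" and "\<theta> = tilt b \<rho> d n"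
    define \<delta> where "\<delta> = C1 * exp (- a * real p powr b)"
    have n: "1 < real n" using elim by simp
    have p: "0 < p" "p \<le> n" and \<theta>: "0 < \<theta>" "\<theta> \<le> 1" "\<theta> * (2 * C * m) \<le> 1"
      and expo: "real n / real p * (\<theta>\<^sup>2 * m) = L"
      and large: "sqrt (L ^ 3 / 2) \<le> \<theta> * (real n * r / real p)"
      and \<delta>L: "\<delta> \<le> C1 * exp (- a * L\<^sup>2)"
      using elim(1) C1 by (auto simp: p_def \<theta>_def L_def m_def r_def \<delta>_def)
    have dec_p: "decoupled M N X p \<delta>" using elim(3) by (simp add: p_def \<delta>_def)
    have m: "1 \<le> m" "0 < m" "m \<le> real n" using elim(2) bandwidth_ge_1[of b \<rho> d n] by (auto simp: m_def)
    have \<delta>: "0 \<le> \<delta>" using C1 by (simp add: \<delta>_def)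
    show ?case
    proof
      fix x
      have Km [measurable]: "K m x \<in> borel_measurable borel"
        using borel_measurable_if_lipschitz[OF assms(3), of "K m x"] Kl[OF m(2)] by blast
      define e where "e = (\<integral>\<omega>. K m x (X 0 \<omega>) \<partial>M)"
      have e: "(\<integral>\<omega>. K m x (X j \<omega>) \<partial>M) = e" for j
        unfolding e_def by (rule expectation_eq_if_same_density[OF density f(1) Km])
      have iK: "integrable M (\<lambda>\<omega>. K m x (X j \<omega>))" for j
        by (rule integrable_const_bound[of _ "C * m"]) (use Kb[OF m(2)] in auto)
      have iK2: "integrable M (\<lambda>\<omega>. (K m x (X j \<omega>))\<^sup>2)" for j
      proof (rule integrable_const_bound[of _ "(C * m)\<^sup>2"])
        show "AE \<omega> in M. norm ((K m x (X j \<omega>))\<^sup>2) \<le> (C * m)\<^sup>2"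
          using Kb[OF m(2), of x] by (intro AE_I2) (use C m in \<open>simp add: abs_le_square_iff[symmetric] abs_mult\<close>)
      qed measurable
      have "\<bar>e\<bar> \<le> (\<integral>\<omega>. \<bar>K m x (X 0 \<omega>)\<bar> \<partial>M)" unfolding e_def by (rule integral_abs_bound)
      also have "\<dots> \<le> (\<integral>\<omega>. C * m \<partial>M)" using iK Kb[OF m(2)] by (intro integral_mono) auto
      finally have eb: "\<bar>e\<bar> \<le> C * m" by (simp add: prob_space)
      define \<zeta> where "\<zeta> = (\<lambda>y. K m x y - e)"
      have \<zeta>l: "\<bar>\<zeta> y - \<zeta> y'\<bar> \<le> (C * m powr (1 + 1 / d)) * N (y - y')" for y y'
        using Kl[OF m(2)] by (simp add: \<zeta>_def)
      have \<zeta>b: "\<bar>\<theta> * \<zeta> y\<bar> \<le> 1" for y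
      proof -
        have "\<bar>\<zeta> y\<bar> \<le> 2 * C * m" using Kb[OF m(2), of x y] eb by (simp add: \<zeta>_def)
        then have "\<theta> * \<bar>\<zeta> y\<bar> \<le> \<theta> * (2 * C * m)" using \<theta> by (intro mult_left_mono) auto
        then have "\<theta> * \<bar>\<zeta> y\<bar> \<le> 1" using \<theta>(3) by linarith
        then show ?thesis using \<theta>(1) by (simp add: abs_mult)
      qed
      have \<zeta>m: "(\<integral>\<omega>. \<zeta> (X j \<omega>) \<partial>M) = 0" for j
        using iK e by (simp add: \<zeta>_def prob_space)
      have \<zeta>v: "(\<integral>\<omega>. (\<zeta> (X j \<omega>))\<^sup>2 \<partial>M) \<le> V * m" for j
      proof -
        have "(\<integral>\<omega>. (\<zeta> (X j \<omega>))\<^sup>2 \<partial>M) = (\<integral>\<omega>. (K m x (X j \<omega>))\<^sup>2 \<partial>M) - e\<^sup>2"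
          using variance_eq[OF iK iK2, of j] by (simp add: \<zeta>_def e)
        also have "\<dots> \<le> (\<integral>\<omega>. (K m x (X j \<omega>))\<^sup>2 \<partial>M)" by simp
        also have "\<dots> \<le> (C * m)\<^sup>2 * (B * (C / m))"
          using Ks[OF m(2), of x] Kb[OF m(2)] C m B
          by (intro second_moment_le[OF assms(2) density]) (auto intro: f)
        also have "\<dots> = V * m" using m by (simp add: V_def power2_eq_square)
        finally show ?thesis .
      qed
      have fl: "real n * fluctuation M K (bandwidth b \<rho> d) X n \<omega> x = (\<Sum>i=1..n. \<zeta> (X (int i) \<omega>))" for \<omega>
      proof -
        have "(\<integral>\<omega>'. estimator K (bandwidth b \<rho> d) X n \<omega>' x \<partial>M) = e"
          using n iK by (simp add: estimator_def m_def[symmetric] e)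
        then show ?thesis
          using n by (simp add: fluctuation_def estimator_def m_def[symmetric] \<zeta>_def sum_subtractf field_simps)
      qed
      have "{\<omega> \<in> space M. r \<le> \<bar>fluctuation M K (bandwidth b \<rho> d) X n \<omega> x\<bar>}
          = {\<omega> \<in> space M. real n * r \<le> \<bar>\<Sum>i=1..n. \<zeta> (X (int i) \<omega>)\<bar>}"
        using n by (simp add: fl[symmetric] abs_mult del: One_nat_def)
      then have "measure M {\<omega> \<in> space M. r \<le> \<bar>fluctuation M K (bandwidth b \<rho> d) X n \<omega> x\<bar>}
          \<le> 4 * real n * exp (2 * real n / real p * (\<theta>\<^sup>2 * (V * m))) *
             (exp (- \<theta> * (real n * r / real p)) + 2 * real n * (real n + 2) * (\<theta> * (C * m powr (1 + 1 / d))) * \<delta>)"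
        using full_sum_tail[OF assms(2,3) Xm dec_p \<delta> p \<zeta>l _ \<zeta>b \<theta>(1) \<zeta>m \<zeta>v, of "real n * r"] C m by simp
      also have "2 * real n / real p * (\<theta>\<^sup>2 * (V * m)) = 2 * V * (real n / real p * (\<theta>\<^sup>2 * m))" by simp
      also have "\<dots> = 2 * V * L" unfolding expo ..
      also have "4 * real n * exp (2 * V * L) *
             (exp (- \<theta> * (real n * r / real p)) + 2 * real n * (real n + 2) * (\<theta> * (C * m powr (1 + 1 / d))) * \<delta>)
          \<le> 4 * real n * exp (2 * V * L) * (exp (- sqrt (L ^ 3 / 2)) + 6 * C * C1 * real n ^ 5 * exp (- a * L\<^sup>2))"
      proof (intro mult_left_mono add_mono)
        show "exp (- \<theta> * (real n * r / real p)) \<le> exp (- sqrt (L ^ 3 / 2))" using large by simp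
        have "m powr (1 + 1 / d) \<le> m powr 2" using m d by (intro powr_mono) auto
        also have "\<dots> \<le> real n powr 2" using m by (intro powr_mono2) auto
        finally have mn: "m powr (1 + 1 / d) \<le> (real n)\<^sup>2" using n by simp
        have n1: "real n + 2 \<le> 3 * real n" using n by simp
        have "2 * real n * (real n + 2) * (\<theta> * (C * m powr (1 + 1 / d))) * \<delta>
            \<le> 2 * real n * (3 * real n) * (1 * (C * (real n)\<^sup>2)) * (C1 * exp (- a * L\<^sup>2))"
          using \<theta> C \<delta> \<delta>L mn n1 n by (intro mult_mono) auto
        also have "\<dots> = 6 * C * C1 * exp (- a * L\<^sup>2) * (real n ^ 4 * 1)"
          by (simp add: power2_eq_square power4_eq_xxxx)
        also have "\<dots> \<le> 6 * C * C1 * exp (- a * L\<^sup>2) * (real n ^ 4 * real n)"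
          using C C1 n by (intro mult_left_mono) auto
        also have "\<dots> = 6 * C * C1 * real n ^ 5 * exp (- a * L\<^sup>2)"
          by (simp add: power_Suc2[symmetric] eval_nat_numeral)
        finally show "2 * real n * (real n + 2) * (\<theta> * (C * m powr (1 + 1 / d))) * \<delta>
            \<le> 6 * C * C1 * real n ^ 5 * exp (- a * L\<^sup>2)" .
      qed auto
      also have "\<dots> \<le> real n powr (- A)" using elim(4) by (simp add: L_def)
      finally show "measure M {\<omega> \<in> space M. rate b \<rho> d n \<le> \<bar>fluctuation M K (bandwidth b \<rho> d) X n \<omega> x\<bar>} \<le> real n powr (- A)"
        by (simp add: r_def)
    qed
  qed
qed

text \<open>Discretisation: both the estimator and its mean have in \<open>x\<close> a Lipschitz constant at most of order
  \<open>n\<^sup>2\<close>, so a net of mesh \<open>n powr (- 3)\<close> resolves the fluctuation up to order \<open>1 / n\<close>, which is within the rate.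
  The net has polynomially many points, and the union bound absorbs them because the pointwise tail
  decays faster than any power. The constant \<open>D\<close> does not depend on the power \<open>A\<close>, as is needed when
  \<open>A\<close> is chosen later according to the moment to be bounded.\<close>

lemma uniform_fluctuation_tail:
  fixes N :: "'v::euclidean_space \<Rightarrow> real" and f :: "'v \<Rightarrow> real"
  defines "d \<equiv> real DIM('v)"
  assumes "prob_space M" "is_norm N" "0 < \<rho>" "0 < a" "0 < b"
    and density: "\<And>n. distributed M lborel (X n) (\<lambda>x. ennreal (f x))"
    and f: "\<And>x. 0 \<le> f x" "\<And>x. f x \<le> B"
    and dec: "\<forall>\<^sub>F r in sequentially. decoupled M N X r (C1 * exp (- a * real r powr b))" and C1: "0 < C1"
    and K: "small_supports N K" "lipschitz_kernels N K"
  obtains D where "0 \<le> D" "\<And>A. \<exists>Bad. (\<forall>n. Bad n \<in> sets M) \<and>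
    (\<forall>\<^sub>F n in sequentially. measure M (Bad n) \<le> real n powr (- A) \<and>
      (\<forall>\<omega> \<in> space M - Bad n. \<forall>x. N x \<le> R \<longrightarrow>
        \<bar>fluctuation M K (bandwidth b \<rho> d) X n \<omega> x\<bar> \<le> D * rate b \<rho> d n))"
proof -
  interpret prob_space M by fact
  have Xm [measurable]: "X n \<in> borel_measurable M" for n
    using distributed_measurable[OF density[of n]] by simp
  have d: "1 \<le> d" "0 < d" by (simp_all add: d_def Suc_leI)
  obtain C where C: "1 \<le> C"
    and Kb: "\<And>m x y. 0 < m \<Longrightarrow> \<bar>K m x y\<bar> \<le> C * m"
    and Kl1: "\<And>m x x' y. 0 < m \<Longrightarrow> \<bar>K m x y - K m x' y\<bar> \<le> C * m powr (1 + 1 / d) * N (x - x')"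
    and Kl: "\<And>m x x' y. 0 < m \<Longrightarrow> \<bar>K m y x - K m y x'\<bar> \<le> C * m powr (1 + 1 / d) * N (x - x')"
    using kernel_bounds[OF assms(3) K] unfolding d_def by metis
  obtain Cg c where Cg: "0 \<le> Cg" "0 \<le> c"
    and net: "\<And>k::nat. 0 < k \<Longrightarrow> \<exists>G. finite G \<and> real (card G) \<le> Cg * real k ^ DIM('v) \<and>
       (\<forall>x::'v. N x \<le> R \<longrightarrow> (\<exists>g\<in>G. N (x - g) \<le> c / real k))"
    using polynomial_net[OF assms(3), of R] by metis
  have "\<forall>n. \<exists>G. finite G \<and> real (card G) \<le> Cg * real (Suc n ^ 3) ^ DIM('v) \<and>
       (\<forall>x::'v. N x \<le> R \<longrightarrow> (\<exists>g\<in>G. N (x - g) \<le> c / real (Suc n ^ 3)))"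
    by (intro allI net) simp
  then obtain G where G: "\<And>n. finite (G n)" "\<And>n. real (card (G n)) \<le> Cg * real (Suc n ^ 3) ^ DIM('v)"
      "\<And>n x. N x \<le> R \<Longrightarrow> \<exists>g\<in>G n. N (x - g) \<le> c / real (Suc n ^ 3)"
    by metis
  let ?m = "bandwidth b \<rho> d" and ?r = "rate b \<rho> d"
  have m: "0 < ?m n" "1 \<le> ?m n" for n using bandwidth_ge_1[of b \<rho> d n] by auto
  have Km [measurable]: "K (?m n) x \<in> borel_measurable borel" for n x
    using borel_measurable_if_lipschitz[OF assms(3), of "K (?m n) x"] Kl[OF m(1)] by blast
  have em [measurable]: "(\<lambda>\<omega>. estimator K ?m X n \<omega> x) \<in> borel_measurable M" for n x
    unfolding estimator_def by measurable
  have ie: "integrable M (\<lambda>\<omega>. estimator K ?m X n \<omega> x)" for n x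
  proof (rule integrable_const_bound[of _ "C * ?m n"])
    show "AE \<omega> in M. norm (estimator K ?m X n \<omega> x) \<le> C * ?m n"
      unfolding real_norm_def by (intro AE_I2 estimator_abs_le Kb m) (use C m[of n] in auto)
  qed measurable
  have fm [measurable]: "(\<lambda>\<omega>. fluctuation M K ?m X n \<omega> x) \<in> borel_measurable M" for n x
    unfolding fluctuation_def by measurable
  have fl: "\<bar>fluctuation M K ?m X n \<omega> x - fluctuation M K ?m X n \<omega> x'\<bar>
      \<le> 2 * (C * ?m n powr (1 + 1 / d) * N (x - x'))" for n \<omega> x x'
  proof -
    let ?c = "C * ?m n powr (1 + 1 / d) * N (x - x')"
    have c0: "0 \<le> ?c" using C is_norm_nonneg[OF assms(3)] by simp
    have e: "\<bar>estimator K ?m X n \<omega> x - estimator K ?m X n \<omega> x'\<bar> \<le> ?c" for \<omega>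
      by (rule estimator_diff_le) (rule Kl1[OF m(1)], rule c0)
    have "\<bar>(\<integral>\<omega>. estimator K ?m X n \<omega> x \<partial>M) - (\<integral>\<omega>. estimator K ?m X n \<omega> x' \<partial>M)\<bar>
        = \<bar>\<integral>\<omega>. estimator K ?m X n \<omega> x - estimator K ?m X n \<omega> x' \<partial>M\<bar>" using ie by simp
    also have "\<dots> \<le> (\<integral>\<omega>. \<bar>estimator K ?m X n \<omega> x - estimator K ?m X n \<omega> x'\<bar> \<partial>M)" by (rule integral_abs_bound)
    also have "\<dots> \<le> (\<integral>\<omega>. ?c \<partial>M)" using ie e by (intro integral_mono) auto
    also have "\<dots> = ?c" by (simp add: prob_space)
    finally show ?thesis using e[of \<omega>] unfolding fluctuation_def by linarith
  qed
  \<comment> \<open>The rate at the points of the net, plus the oscillation between them.\<close>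
  define D where "D = 1 + 2 * C * c"
  show ?thesis
  proof (rule that[of D])
    show "0 \<le> D" using C Cg by (simp add: D_def)
    fix A :: real
    define Bad where "Bad = (\<lambda>n. \<Union>g\<in>G n. {\<omega> \<in> space M. ?r n \<le> \<bar>fluctuation M K ?m X n \<omega> g\<bar>})"
    have Bad: "Bad n \<in> sets M" for n
      unfolding Bad_def using G(1) by (intro sets.finite_UN) auto
    \<comment> \<open>The net costs \<open>n powr (3 * d)\<close>; the last unit of the exponent absorbs the constants.\<close>
    let ?A = "A + 3 * d + 1"
    have "\<forall>\<^sub>F n in sequentially. measure M (Bad n) \<le> real n powr (- A) \<and>
      (\<forall>\<omega> \<in> space M - Bad n. \<forall>x. N x \<le> R \<longrightarrow> \<bar>fluctuation M K ?m X n \<omega> x\<bar> \<le> D * ?r n)"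
      using pointwise_fluctuation_tail[where A = ?A, OF assms(2-6) density f dec C1 K]
        eventually_rate_bandwidth[OF \<open>0 < b\<close> \<open>0 < \<rho>\<close> d(2)]
        eventually_gt_at_top[of 1] eventually_ge_at_top[of "nat \<lceil>Cg * 8 ^ DIM('v)\<rceil>"]
    proof eventually_elim
      case (elim n)
      have tail: "measure M {\<omega> \<in> space M. ?r n \<le> \<bar>fluctuation M K ?m X n \<omega> x\<bar>} \<le> real n powr (- ?A)" for x
        using elim(1) by (simp add: d_def)
      have n: "1 < real n" using elim by simp
      have big: "Cg * 8 ^ DIM('v) \<le> real n" using elim(4) by linarith
      have "measure M (Bad n) \<le> (\<Sum>g\<in>G n. measure M {\<omega> \<in> space M. ?r n \<le> \<bar>fluctuation M K ?m X n \<omega> g\<bar>})"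
        unfolding Bad_def by (rule measure_UNION_le[OF G(1)]) measurable
      also have "\<dots> \<le> (\<Sum>g\<in>G n. real n powr (- ?A))" by (intro sum_mono tail)
      also have "\<dots> = real (card (G n)) * real n powr (- ?A)" by simp
      also have "\<dots> \<le> Cg * real (Suc n ^ 3) ^ DIM('v) * real n powr (- ?A)"
        by (intro mult_right_mono G(2)) auto
      also have "\<dots> \<le> Cg * (8 * real n ^ 3) ^ DIM('v) * real n powr (- ?A)"
      proof (intro mult_right_mono mult_left_mono power_mono)
        have "real (Suc n) ^ 3 \<le> (2 * real n) ^ 3" using n by (intro power_mono) auto
        then show "real (Suc n ^ 3) \<le> 8 * real n ^ 3" by (simp add: power_mult_distrib)
      qed (use Cg in auto)
      also have "\<dots> = (Cg * 8 ^ DIM('v)) * (real n powr (3 * d) * real n powr (- ?A))"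
      proof -
        have "(real n ^ 3) ^ DIM('v) = real n ^ (3 * DIM('v))" by (simp add: power_mult)
        also have "\<dots> = real n powr (3 * d)" using n by (simp add: d_def powr_realpow[symmetric])
        finally show ?thesis by (simp add: power_mult_distrib)
      qed
      also have "\<dots> \<le> real n * (real n powr (3 * d) * real n powr (- ?A))"
        using big by (intro mult_right_mono) auto
      also have "\<dots> = real n powr (1 + (3 * d + - ?A))" using n by (simp only: powr_add) simp
      also have "1 + (3 * d + - ?A) = - A" by simp
      finally have 1: "measure M (Bad n) \<le> real n powr (- A)" .
      have 2: "\<bar>fluctuation M K ?m X n \<omega> x\<bar> \<le> D * ?r n" if \<omega>: "\<omega> \<in> space M - Bad n" and x: "N x \<le> R" for \<omega> x
      proof -
        obtain g where g: "g \<in> G n" "N (x - g) \<le> c / real (Suc n ^ 3)" using G(3)[OF x] by blast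
        have "\<bar>fluctuation M K ?m X n \<omega> g\<bar> < ?r n" using g \<omega> by (auto simp: Bad_def not_le)
        moreover have "\<bar>fluctuation M K ?m X n \<omega> x - fluctuation M K ?m X n \<omega> g\<bar> \<le> 2 * C * c * ?r n"
        proof -
          have "?m n powr (1 + 1 / d) \<le> ?m n powr 2" using m d by (intro powr_mono) auto
          also have "\<dots> \<le> real n powr 2" using m[of n] elim(2) by (intro powr_mono2) auto
          finally have mn: "?m n powr (1 + 1 / d) \<le> (real n)\<^sup>2" using n by simp
          have "c / real (Suc n ^ 3) \<le> c / real n ^ 3"
            using Cg n by (intro divide_left_mono) (auto intro!: power_mono)
          then have gx: "N (x - g) \<le> c / real n ^ 3" using g by linarith
          have "2 * (C * ?m n powr (1 + 1 / d) * N (x - g)) \<le> 2 * (C * (real n)\<^sup>2 * (c / real n ^ 3))"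
            using C mn gx is_norm_nonneg[OF assms(3)] by (intro mult_left_mono mult_mono) auto
          also have "\<dots> = 2 * C * c * (1 / real n)" using n by (simp add: power2_eq_square power3_eq_cube)
          also have "\<dots> \<le> 2 * C * c * ?r n" using C Cg elim(2) by (intro mult_left_mono) auto
          finally show ?thesis using fl[of n \<omega> x g] by linarith
        qed
        ultimately show ?thesis unfolding D_def by (simp add: algebra_simps)
      qed
      show ?case using 1 2 by blast
    qed
    then show "\<exists>Bad. (\<forall>n. Bad n \<in> sets M) \<and> (\<forall>\<^sub>F n in sequentially. measure M (Bad n) \<le> real n powr (- A) \<and>
      (\<forall>\<omega> \<in> space M - Bad n. \<forall>x. N x \<le> R \<longrightarrow> \<bar>fluctuation M K ?m X n \<omega> x\<bar> \<le> D * ?r n))"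
      using Bad by (intro exI[of _ Bad]) blast
  qed
qed

section \<open>Rates of convergence\<close>

theorem theorem2:
  fixes M :: "'w measure"
    and N :: "real ^ 'd::finite \<Rightarrow> real"
    and X :: "int \<Rightarrow> 'w \<Rightarrow> real ^ 'd"
    and f :: "real ^ 'd \<Rightarrow> real"
    and \<rho> a b :: real
  assumes "prob_space M"
    and "is_norm N"
    and "\<rho> > 0"
    and "a > 0" and "b > 0"
    and density: "\<And>n. distributed M lborel (X n) (\<lambda>x. ennreal (f x))"
    and f_nonneg: "\<And>x. 0 \<le> f x"
    and f_bounded: "\<exists>B. \<forall>x. f x \<le> B"
    and joint: "bounded_joint_densities M X \<or> dynamical_system_in_F M X"
    and dependence:
      "(\<exists>\<eta>. eta_weakly_dependent M N X \<eta> \<and> \<eta> \<in> O(\<lambda>r. exp (- a * real r powr b))) \<or>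
       (phi_tilde_dependent M N X \<and>
        ennreal_bigo (phi_tilde_coeff M N X) (\<lambda>r. exp (- a * real r powr b)))"
  shows "\<exists>m :: nat \<Rightarrow> real. (\<forall>n. m n > 0) \<and> filterlim m at_top sequentially \<and>
    (\<forall>K. admissible_kernels M N X f m K \<rho> \<longrightarrow>
      (\<forall>R>0.
        (\<forall>q>0. ennreal_bigo
           (\<lambda>n. \<integral>\<^sup>+\<omega>. (SUP x \<in> {x. N x \<le> R}. ennreal (\<bar>estimator K m X n \<omega> x - f x\<bar> powr q)) \<partial>M)
           (\<lambda>n. (ln (real n) powr (2 * (b + 1) / b) / real n)
                  powr (q * \<rho> / (real CARD('d) + 2 * \<rho>)))) \<and>
        (AE \<omega> in M. ennreal_bigo
           (\<lambda>n. SUP x \<in> {x. N x \<le> R}. ennreal \<bar>estimator K m X n \<omega> x - f x\<bar>)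
           (\<lambda>n. (ln (real n) powr (2 * (b + 1) / b) / real n)
                  powr (\<rho> / (real CARD('d) + 2 * \<rho>))))))"
proof -
  interpret prob_space M by fact
  define d where "d = real DIM(real ^ 'd)"
  have dC: "d = real CARD('d)" by (simp add: d_def)
  have d: "0 < d" by (simp add: d_def)
  have Xm: "X n \<in> borel_measurable M" for n
    using distributed_measurable[OF density[of n]] by simp
  obtain B where B: "\<And>x. f x \<le> B" using f_bounded by blast
  have B0: "0 \<le> B" using B[of 0] f_nonneg[of 0] by linarith
  obtain C1 where C1: "0 < C1"
    and dec: "\<forall>\<^sub>F r in sequentially. decoupled M N X r (C1 * exp (- a * real r powr b))"
    using eventually_decoupled[OF assms(1,2) Xm dependence] by blast
  let ?m = "bandwidth b \<rho> d" and ?r = "rate b \<rho> d"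
  have mpos: "0 < ?m n" for n using bandwidth_ge_1[of b \<rho> d n] by linarith
  show ?thesis
  proof (intro exI[of _ ?m] conjI allI impI)
    show "0 < ?m n" for n by (rule mpos)
    show "filterlim ?m at_top sequentially" using \<open>b > 0\<close> \<open>\<rho> > 0\<close> d by (rule bandwidth_at_top)
    fix K :: "real \<Rightarrow> real ^ 'd \<Rightarrow> real ^ 'd \<Rightarrow> real" and R :: real
    assume adm: "admissible_kernels M N X f ?m K \<rho>" and R: "0 < R"
    then have K: "small_supports N K" "lipschitz_kernels N K" and bias: "bias_order M N X f ?m K \<rho>"
      unfolding admissible_kernels_def by auto
    obtain C where C: "1 \<le> C" and Kb: "\<And>m x y. 0 < m \<Longrightarrow> \<bar>K m x y\<bar> \<le> C * m"
      using kernel_bounds[OF assms(2) K] by metis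
    obtain D where D: "0 \<le> D" and tails: "\<And>A. \<exists>Bad. (\<forall>n. Bad n \<in> sets M) \<and>
      (\<forall>\<^sub>F n in sequentially. measure M (Bad n) \<le> real n powr (- A) \<and>
        (\<forall>\<omega> \<in> space M - Bad n. \<forall>x. N x \<le> R \<longrightarrow> \<bar>fluctuation M K ?m X n \<omega> x\<bar> \<le> D * ?r n))"
      by (rule uniform_fluctuation_tail[where R = R, OF assms(1-5) density f_nonneg B dec C1 K, folded d_def]) (rule that)
    obtain C2 where C2: "\<forall>\<^sub>F n in sequentially.
        (SUP x \<in> {x. N x \<le> R}. ennreal \<bar>(\<integral>\<omega>. estimator K ?m X n \<omega> x \<partial>M) - f x\<bar>)
          \<le> ennreal (C2 * ?m n powr (- \<rho> / d))"
      using bias R unfolding bias_order_def ennreal_bigo_def d_def by blast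
    define E where "E = D + \<bar>C2\<bar>"
    have E: "0 \<le> E" using D by (simp add: E_def)
    have good: "\<exists>Bad. (\<forall>n. Bad n \<in> sets M) \<and>
      (\<forall>\<^sub>F n in sequentially. measure M (Bad n) \<le> real n powr (- A) \<and>
        (\<forall>\<omega> \<in> space M - Bad n. \<forall>x. N x \<le> R \<longrightarrow> \<bar>estimator K ?m X n \<omega> x - f x\<bar> \<le> E * ?r n))" for A
    proof -
      obtain Bad where Bad: "\<forall>n. Bad n \<in> sets M" and ev: "\<forall>\<^sub>F n in sequentially. measure M (Bad n) \<le> real n powr (- A) \<and>
        (\<forall>\<omega> \<in> space M - Bad n. \<forall>x. N x \<le> R \<longrightarrow> \<bar>fluctuation M K ?m X n \<omega> x\<bar> \<le> D * ?r n)"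
        using tails[of A] by blast
      have "\<forall>\<^sub>F n in sequentially. measure M (Bad n) \<le> real n powr (- A) \<and>
        (\<forall>\<omega> \<in> space M - Bad n. \<forall>x. N x \<le> R \<longrightarrow> \<bar>estimator K ?m X n \<omega> x - f x\<bar> \<le> E * ?r n)"
        using ev C2 eventually_rate_bandwidth[OF \<open>b > 0\<close> \<open>\<rho> > 0\<close> d]
      proof eventually_elim
        case (elim n)
        have r: "0 \<le> ?r n" by (simp add: rate_def)
        have "\<bar>estimator K ?m X n \<omega> x - f x\<bar> \<le> E * ?r n" if "\<omega> \<in> space M - Bad n" "N x \<le> R" for \<omega> x
        proof -
          have "ennreal \<bar>(\<integral>\<omega>. estimator K ?m X n \<omega> x \<partial>M) - f x\<bar> \<le> ennreal (C2 * ?r n)"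
            using elim(2,3) that(2) by (auto simp: SUP_le_iff)
          also have "\<dots> \<le> ennreal (\<bar>C2\<bar> * ?r n)" using r by (intro ennreal_leI mult_right_mono) auto
          finally have "\<bar>(\<integral>\<omega>. estimator K ?m X n \<omega> x \<partial>M) - f x\<bar> \<le> \<bar>C2\<bar> * ?r n" using r by simp
          moreover have "\<bar>fluctuation M K ?m X n \<omega> x\<bar> \<le> D * ?r n" using elim(1) that by blast
          ultimately show ?thesis unfolding fluctuation_def E_def distrib_right by linarith
        qed
        then show ?case using elim(1) by blast
      qed
      then show ?thesis using Bad by blast
    qed
    show "ennreal_bigo
       (\<lambda>n. \<integral>\<^sup>+\<omega>. (SUP x \<in> {x. N x \<le> R}. ennreal (\<bar>estimator K ?m X n \<omega> x - f x\<bar> powr q)) \<partial>M)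
       (\<lambda>n. (ln (real n) powr (2 * (b + 1) / b) / real n) powr (q * \<rho> / (real CARD('d) + 2 * \<rho>)))"
      if q: "0 < q" for q
    proof -
      obtain Bad where Bad: "\<And>n. Bad n \<in> sets M" and ev: "\<forall>\<^sub>F n in sequentially. measure M (Bad n) \<le> real n powr (- (2 * q)) \<and>
        (\<forall>\<omega> \<in> space M - Bad n. \<forall>x. N x \<le> R \<longrightarrow> \<bar>estimator K ?m X n \<omega> x - f x\<bar> \<le> E * ?r n)"
        using good[of "2 * q"] by blast
      have rq: "(ln (real n) powr (2 * (b + 1) / b) / real n) powr (q * \<rho> / (real CARD('d) + 2 * \<rho>)) = ?r n powr q" for n
        by (simp add: rate_def powr_powr dC mult.commute)
      show ?thesis
        unfolding ennreal_bigo_def rq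
      proof (rule exI[of _ "E powr q + (C + B) powr q"])
        show "\<forall>\<^sub>F n in sequentially. (\<integral>\<^sup>+\<omega>. (SUP x \<in> {x. N x \<le> R}. ennreal (\<bar>estimator K ?m X n \<omega> x - f x\<bar> powr q)) \<partial>M)
           \<le> ennreal ((E powr q + (C + B) powr q) * ?r n powr q)"
          using ev eventually_rate_bandwidth[OF \<open>b > 0\<close> \<open>\<rho> > 0\<close> d] eventually_gt_at_top[of 1]
        proof eventually_elim
          case (elim n)
          have n: "1 < real n" using elim by simp
          have r: "1 / real n \<le> ?r n" "0 \<le> ?r n" using elim(2) by (auto simp: rate_def)
          \<comment> \<open>A polynomial bound suffices on the exceptional event, which has probability at most \<open>n powr (- (2 * q))\<close>.\<close>
          have crude: "\<bar>estimator K ?m X n \<omega> x - f x\<bar> \<le> (C + B) * real n" for \<omega> x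
          proof -
            have "\<bar>estimator K ?m X n \<omega> x\<bar> \<le> C * ?m n"
              by (rule estimator_abs_le) (use Kb[OF mpos] C mpos[of n] in auto)
            also have "\<dots> \<le> C * real n" using C elim(2) by (intro mult_left_mono) auto
            finally have "\<bar>estimator K ?m X n \<omega> x\<bar> \<le> C * real n" .
            moreover have "B * 1 \<le> B * real n" using B0 n by (intro mult_left_mono) auto
            ultimately show ?thesis using B[of x] f_nonneg[of x] unfolding distrib_right by linarith
          qed
          have "(\<integral>\<^sup>+\<omega>. (SUP x \<in> {x. N x \<le> R}. ennreal (\<bar>estimator K ?m X n \<omega> x - f x\<bar> powr q)) \<partial>M)
              \<le> (\<integral>\<^sup>+\<omega>. ennreal ((E * ?r n) powr q) + ennreal (((C + B) * real n) powr q) * indicator (Bad n) \<omega> \<partial>M)"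
          proof (intro nn_integral_mono SUP_least)
            fix \<omega> x assume \<omega>: "\<omega> \<in> space M" and x: "x \<in> {x. N x \<le> R}"
            show "ennreal (\<bar>estimator K ?m X n \<omega> x - f x\<bar> powr q)
                \<le> ennreal ((E * ?r n) powr q) + ennreal (((C + B) * real n) powr q) * indicator (Bad n) \<omega>"
            proof (cases "\<omega> \<in> Bad n")
              case True
              have "ennreal (\<bar>estimator K ?m X n \<omega> x - f x\<bar> powr q) \<le> ennreal (((C + B) * real n) powr q)"
                using q crude by (intro ennreal_leI powr_mono2) auto
              then show ?thesis using True by (simp add: add_increasing)
            next
              case False
              then have "\<bar>estimator K ?m X n \<omega> x - f x\<bar> \<le> E * ?r n" using elim(1) \<omega> x by blast
              then have "ennreal (\<bar>estimator K ?m X n \<omega> x - f x\<bar> powr q) \<le> ennreal ((E * ?r n) powr q)"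
                using q by (intro ennreal_leI powr_mono2) auto
              then show ?thesis using False by simp
            qed
          qed
          also have "\<dots> = ennreal ((E * ?r n) powr q) + ennreal (((C + B) * real n) powr q) * emeasure M (Bad n)"
            using Bad by (simp add: nn_integral_add nn_integral_cmult emeasure_space_1)
          also have "\<dots> = ennreal ((E * ?r n) powr q + ((C + B) * real n) powr q * measure M (Bad n))"
            by (simp add: emeasure_eq_measure ennreal_mult ennreal_plus)
          also have "\<dots> \<le> ennreal ((E powr q + (C + B) powr q) * ?r n powr q)"
          proof (rule ennreal_leI)
            have "((C + B) * real n) powr q * measure M (Bad n)
                \<le> ((C + B) * real n) powr q * real n powr (- (2 * q))"
              using elim(1) by (intro mult_left_mono) auto
            also have "\<dots> = (C + B) powr q * (real n powr q * real n powr (- (2 * q)))"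
              using C B0 by (simp add: powr_mult)
            also have "real n powr q * real n powr (- (2 * q)) = real n powr (- q)"
              by (simp add: powr_add[symmetric])
            also have "\<dots> = (1 / real n) powr q"
              using n by (simp add: powr_minus powr_divide inverse_eq_divide)
            also have "(C + B) powr q * (1 / real n) powr q \<le> (C + B) powr q * ?r n powr q"
              using q r n by (intro mult_left_mono powr_mono2) auto
            finally have "((C + B) * real n) powr q * measure M (Bad n) \<le> (C + B) powr q * ?r n powr q" .
            moreover have "(E * ?r n) powr q = E powr q * ?r n powr q" using E r by (simp add: powr_mult)
            ultimately show "(E * ?r n) powr q + ((C + B) * real n) powr q * measure M (Bad n)
                \<le> (E powr q + (C + B) powr q) * ?r n powr q" unfolding distrib_right by linarith
          qed
          finally show ?case .
        qed
      qed
    qed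
    show "AE \<omega> in M. ennreal_bigo
       (\<lambda>n. SUP x \<in> {x. N x \<le> R}. ennreal \<bar>estimator K ?m X n \<omega> x - f x\<bar>)
       (\<lambda>n. (ln (real n) powr (2 * (b + 1) / b) / real n) powr (\<rho> / (real CARD('d) + 2 * \<rho>)))"
    proof -
      obtain Bad where Bad: "\<And>n. Bad n \<in> sets M" and ev: "\<forall>\<^sub>F n in sequentially. measure M (Bad n) \<le> real n powr (- 2) \<and>
        (\<forall>\<omega> \<in> space M - Bad n. \<forall>x. N x \<le> R \<longrightarrow> \<bar>estimator K ?m X n \<omega> x - f x\<bar> \<le> E * ?r n)"
        using good[of 2] by blast
      have "summable (\<lambda>n. measure M (Bad n))"
      proof (rule summable_comparison_test_ev)
        show "\<forall>\<^sub>F n in sequentially. norm (measure M (Bad n)) \<le> real n powr (- 2)"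
          using ev by eventually_elim simp
        show "summable (\<lambda>n. real n powr (- 2))" by (simp add: summable_real_powr_iff)
      qed
      then have "AE \<omega> in M. \<forall>\<^sub>F n in sequentially. \<omega> \<in> space M - Bad n"
        using Bad by (intro borel_cantelli_AE1) (auto simp: less_top[symmetric])
      then show ?thesis
      proof eventually_elim
        case (elim \<omega>)
        have "\<forall>\<^sub>F n in sequentially. (SUP x \<in> {x. N x \<le> R}. ennreal \<bar>estimator K ?m X n \<omega> x - f x\<bar>)
            \<le> ennreal (E * ?r n)"
          using elim ev by eventually_elim (auto intro!: SUP_least ennreal_leI)
        then show ?case unfolding ennreal_bigo_def rate_def dC by blast
      qed
    qed
  qed
qed

end
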